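(* Let $\mathcal{A}$ be a strongly connected $d$-dimensional VASS MDP, let $(\mathbf{y},\mathbf{z})$ be a maximal solution of constraint system (II), and let $c\in\{1,\dots,d\}$ be a counter. If $\mathbf{y}(c)>0$, then $n\mapsto n$ is a tight estimate of $\mathcal{C}[c]$ for the only type of $\mathcal{A}$. If $\mathbf{y}(c)=0$, then $n\mapsto n^2$ is a lower estimate of $\mathcal{C}[c]$ for the only type of $\mathcal{A}$.
   Context: Let $d\ge 1$. A $d$-dimensional VASS MDP is a tuple $\mathcal{A}=(Q,(Q_n,Q_p),T,P)$, where $Q$ is a finite nonempty set of states partitioned into nondeterministic states $Q_n$ and probabilistic states $Q_p$; $T\subseteq Q\times\mathbb{Z}^d\times Q$ is a finite set of transitions such that for every $p\in Q$ the set $\mathit{Out}(p)$ of transitions of the form $(p,\mathbf{u},q)$ is nonempty; and $P$ assigns to every $t\in\mathit{Out}(p)$ with $p\in Q_p$ a positive rational probability such that $\sum_{t\in\mathit{Out}(p)}P(t)=1$. $\mathit{In}(p)$ is the set of transitions of the form $(q,\mathbf{u},p)$; for $t=(p,\mathbf{u},q)$ write $\mathbf{u}_t=\mathbf{u}$. A strategy $\sigma$ maps every finite path ending in a state $p\in Q_n$ to a probability distribution over $\mathit{Out}(p)$. A configuration $p\mathbf{v}$ ($p\in Q$, $\mathbf{v}\in\mathbb{Z}^d$) is terminal if some component of $\mathbf{v}$ is negative. A computation from $p\mathbf{v}$ along an infinite path $p_0,\mathbf{u}_1,p_1,\dots$ is $p_0\mathbf{v}_0,p_1\mathbf{v}_1,\dots$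 with $\mathbf{v}_0=\mathbf{v}$, $\mathbf{v}_{i+1}=\mathbf{v}_i+\mathbf{u}_{i+1}$; $\mathit{Term}(\pi)$ is the least $j$ with $p_j\mathbf{v}_j$ terminal ($\infty$ if none). $\mathbb{P}^\sigma_{p\mathbf{v}}$ is the probability measure on computations from $p\mathbf{v}$ under $\sigma$. $\mathbf{n}$ is the vector with all components $n$. $\mathcal{C}[c](\pi)=\sup\{\mathbf{v}_i(c):0\le i<\mathit{Term}(\pi)\}$. $\mathcal{A}$ is strongly connected if its underlying graph is strongly connected; then $(Q,T)$ is its unique maximal end component $M$, every computation has MEC sequence $\mathit{mecs}=M$, and the only type is $\beta=M$. For $f:\mathbb{N}\to\mathbb{N}$: $f$ is a lower estimate of $\mathcal{C}[c]$ for $\beta$ if for every $\varepsilon>0$ there exist $p\in Q$ and strategies $\sigma_1,\sigma_2,\dots$ with $\liminf_{n\to\infty}\mathbb{P}^{\sigma_n}_{p\mathbf{n}}[\mathcal{C}[c]\ge f(n)^{1-\varepsilon}]=1$; $f$ is an upper estimate if for every $\varepsilon>0$, every $p\in Q$ and all strategies $\sigma_1,\sigma_2,\dots$, $\limsup_{n\to\infty}\mathbb{P}^{\sigma_n}_{p\mathbf{n}}[\mathcal{C}[c]\ge f(n)^{1+\varepsilon}]=0$; $f$ is a tight estimate if both. Constraint system (II): find $\mathbf{y}\in\mathbb{Z}^d$, $\mathbf{z}\in\mathbb{Z}^Q$ with $\mathbf{y}\ge\vec 0$, $\mathbf{z}\ge\vec 0$, $\mathbf{z}(q)-\mathbf{z}(p)+\sum_{i=1}^d\mathbf{u}(i)\mathbf{y}(i)\le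 0$ for every $(p,\mathbf{u},q)\in T$ with $p\in Q_n$, and $\sum_{t=(p,\mathbf{u},q)\in\mathit{Out}(p)}P(t)\big(\mathbf{z}(q)-\mathbf{z}(p)+\sum_{i=1}^d\mathbf{u}_t(i)\mathbf{y}(i)\big)\le 0$ for every $p\in Q_p$. Its objective inequalities are $\mathbf{y}(c)>0$ for each counter $c$, the strict versions of the inequality for each $(p,\mathbf{u},q)\in T$ with $p\in Q_n$, and the strict version of the probabilistic inequality for each $p\in Q_p$. A solution is maximal if every objective inequality satisfied strictly by some solution is satisfied strictly by it (such solutions exist since solutions are closed under addition). *)

theory Defs
  imports "HOL-Probability.Probability"
begin

text \<open>A d-dimensional VASS MDP. The state set Q is the (finite, nonempty) type 'q,
  the counters are the elements of the finite (nonempty) type 'd, so d = CARD('d) \<ge> 1.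
  Qn is the set of nondeterministic states, Qp = - Qn the probabilistic ones.
  A transition (p, u, q) is a triple; P assigns probabilities to transitions.\<close>

type_synonym ('q, 'd) trans = "'q \<times> ('d \<Rightarrow> int) \<times> 'q"

definition src :: "('q, 'd) trans \<Rightarrow> 'q" where "src t = fst t"
definition upd :: "('q, 'd) trans \<Rightarrow> ('d \<Rightarrow> int)" where "upd t = fst (snd t)"
definition tgt :: "('q, 'd) trans \<Rightarrow> 'q" where "tgt t = snd (snd t)"

definition Out :: "('q, 'd) trans set \<Rightarrow> 'q \<Rightarrow> ('q, 'd) trans set" where
  "Out T p = {t \<in> T. src t = p}"

definition In :: "('q, 'd) trans set \<Rightarrow> 'q \<Rightarrow> ('q, 'd) trans set" where
  "In T p = {t \<in> T. tgt t = p}"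

definition vass_mdp ::
  "'q::finite set \<Rightarrow> ('q, 'd::finite) trans set \<Rightarrow> (('q, 'd) trans \<Rightarrow> real) \<Rightarrow> bool" where
  "vass_mdp Qn T P \<longleftrightarrow>
     finite T \<and> (\<forall>p. Out T p \<noteq> {}) \<and>
     (\<forall>p. p \<notin> Qn \<longrightarrow> (\<forall>t\<in>Out T p. P t > 0 \<and> P t \<in> \<rat>) \<and> (\<Sum>t\<in>Out T p. P t) = 1)"

definition strongly_connected :: "('q, 'd) trans set \<Rightarrow> bool" where
  "strongly_connected T \<longleftrightarrow> (\<forall>p q. (p, q) \<in> {(src t, tgt t) | t. t \<in> T}\<^sup>*)"

subsection \<open>Finite paths, strategies, and the induced probability measure\<close>

text \<open>A finite path p0, u1, p1, ..., pk is represented by its initial state p0 and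
  the list of its transitions.\<close>

type_synonym ('q, 'd) hist = "'q \<times> ('q, 'd) trans list"

definition last_state :: "('q, 'd) hist \<Rightarrow> 'q" where
  "last_state h = (if snd h = [] then fst h else tgt (last (snd h)))"

definition is_strategy ::
  "'q set \<Rightarrow> ('q, 'd) trans set \<Rightarrow> (('q, 'd) hist \<Rightarrow> ('q, 'd) trans pmf) \<Rightarrow> bool" where
  "is_strategy Qn T \<sigma> \<longleftrightarrow>
     (\<forall>h. last_state h \<in> Qn \<longrightarrow> set_pmf (\<sigma> h) \<subseteq> Out T (last_state h))"

text \<open>Probability of taking transition t after finite path h.\<close>
definition next_prob ::
  "'q set \<Rightarrow> ('q, 'd) trans set \<Rightarrow> (('q, 'd) trans \<Rightarrow> real) \<Rightarrow>
   (('q, 'd) hist \<Rightarrow> ('q, 'd) trans pmf) \<Rightarrow> ('q, 'd) hist \<Rightarrow> ('q, 'd) trans \<Rightarrow> real" where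
  "next_prob Qn T P \<sigma> h t =
     (if last_state h \<in> Qn then pmf (\<sigma> h) t
      else if t \<in> Out T (last_state h) then P t else 0)"

text \<open>Infinite paths from p0 are represented by the sequence of their transitions
  (omega i is the (i+1)-st transition).\<close>
definition path_space :: "(nat \<Rightarrow> ('q, 'd) trans) measure" where
  "path_space = PiM UNIV (\<lambda>_. count_space UNIV)"

definition is_path_measure ::
  "'q set \<Rightarrow> ('q, 'd) trans set \<Rightarrow> (('q, 'd) trans \<Rightarrow> real) \<Rightarrow>
   (('q, 'd) hist \<Rightarrow> ('q, 'd) trans pmf) \<Rightarrow> 'q \<Rightarrow> (nat \<Rightarrow> ('q, 'd) trans) measure \<Rightarrow> bool" where
  "is_path_measure Qn T P \<sigma> p M \<longleftrightarrow>
     sets M = sets path_space \<and> prob_space M \<and>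
     (\<forall>ts. emeasure M {\<omega> \<in> space M. \<forall>i<length ts. \<omega> i = ts ! i} =
            ennreal (\<Prod>i<length ts. next_prob Qn T P \<sigma> (p, take i ts) (ts ! i)))"

text \<open>The (unique) probability measure on runs from initial state p under strategy sigma,
  determined by its values on cylinder sets.\<close>
definition path_measure ::
  "'q set \<Rightarrow> ('q, 'd) trans set \<Rightarrow> (('q, 'd) trans \<Rightarrow> real) \<Rightarrow>
   (('q, 'd) hist \<Rightarrow> ('q, 'd) trans pmf) \<Rightarrow> 'q \<Rightarrow> (nat \<Rightarrow> ('q, 'd) trans) measure" where
  "path_measure Qn T P \<sigma> p = (SOME M. is_path_measure Qn T P \<sigma> p M)"

subsection \<open>Computations and the counter-maximum random variable\<close>

definition cval :: "('d \<Rightarrow> int) \<Rightarrow> (nat \<Rightarrow> ('q, 'd) trans) \<Rightarrow> nat \<Rightarrow> ('d \<Rightarrow> int)" where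
  "cval v \<omega> i = (\<lambda>c. v c + (\<Sum>j<i. upd (\<omega> j) c))"

definition terminal :: "('d \<Rightarrow> int) \<Rightarrow> bool" where
  "terminal w \<longleftrightarrow> (\<exists>c. w c < 0)"

text \<open>C[c](pi) = sup { v_i(c) : 0 <= i < Term(pi) }; i < Term iff no j <= i is terminal.\<close>
definition Cmax :: "'d \<Rightarrow> ('d \<Rightarrow> int) \<Rightarrow> (nat \<Rightarrow> ('q, 'd) trans) \<Rightarrow> ereal" where
  "Cmax c v \<omega> = (SUP i \<in> {i. \<forall>j\<le>i. \<not> terminal (cval v \<omega> j)}. ereal (of_int (cval v \<omega> i c)))"

definition vec_n :: "nat \<Rightarrow> ('d \<Rightarrow> int)" where
  "vec_n n = (\<lambda>_. int n)"

subsection \<open>Estimates (for the only type of a strongly connected VASS MDP)\<close>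

definition lower_estimate ::
  "'q set \<Rightarrow> ('q, 'd) trans set \<Rightarrow> (('q, 'd) trans \<Rightarrow> real) \<Rightarrow> 'd \<Rightarrow> (nat \<Rightarrow> nat) \<Rightarrow> bool" where
  "lower_estimate Qn T P c f \<longleftrightarrow>
     (\<forall>\<epsilon>::real>0. \<exists>p \<sigma>. (\<forall>n. is_strategy Qn T (\<sigma> n)) \<and>
        liminf (\<lambda>n. ereal (measure (path_measure Qn T P (\<sigma> n) p)
            {\<omega>. ereal (real (f n) powr (1 - \<epsilon>)) \<le> Cmax c (vec_n n) \<omega>})) = 1)"

definition upper_estimate ::
  "'q set \<Rightarrow> ('q, 'd) trans set \<Rightarrow> (('q, 'd) trans \<Rightarrow> real) \<Rightarrow> 'd \<Rightarrow> (nat \<Rightarrow> nat) \<Rightarrow> bool" where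
  "upper_estimate Qn T P c f \<longleftrightarrow>
     (\<forall>\<epsilon>::real>0. \<forall>p \<sigma>. (\<forall>n. is_strategy Qn T (\<sigma> n)) \<longrightarrow>
        limsup (\<lambda>n. ereal (measure (path_measure Qn T P (\<sigma> n) p)
            {\<omega>. ereal (real (f n) powr (1 + \<epsilon>)) \<le> Cmax c (vec_n n) \<omega>})) = 0)"

definition tight_estimate ::
  "'q set \<Rightarrow> ('q, 'd) trans set \<Rightarrow> (('q, 'd) trans \<Rightarrow> real) \<Rightarrow> 'd \<Rightarrow> (nat \<Rightarrow> nat) \<Rightarrow> bool" where
  "tight_estimate Qn T P c f \<longleftrightarrow> lower_estimate Qn T P c f \<and> upper_estimate Qn T P c f"

subsection \<open>Constraint system (II)\<close>

definition eff :: "('d::finite \<Rightarrow> int) \<Rightarrow> ('q \<Rightarrow> int) \<Rightarrow> ('q, 'd) trans \<Rightarrow> int" where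
  "eff y z t = z (tgt t) - z (src t) + (\<Sum>i\<in>UNIV. upd t i * y i)"

definition prob_eff ::
  "('q, 'd::finite) trans set \<Rightarrow> (('q, 'd) trans \<Rightarrow> real) \<Rightarrow> ('d \<Rightarrow> int) \<Rightarrow> ('q \<Rightarrow> int) \<Rightarrow> 'q \<Rightarrow> real" where
  "prob_eff T P y z p = (\<Sum>t\<in>Out T p. P t * real_of_int (eff y z t))"

definition is_solution_II ::
  "'q set \<Rightarrow> ('q, 'd::finite) trans set \<Rightarrow> (('q, 'd) trans \<Rightarrow> real) \<Rightarrow>
   ('d \<Rightarrow> int) \<Rightarrow> ('q \<Rightarrow> int) \<Rightarrow> bool" where
  "is_solution_II Qn T P y z \<longleftrightarrow>
     (\<forall>i. y i \<ge> 0) \<and> (\<forall>q. z q \<ge> 0) \<and>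
     (\<forall>t\<in>T. src t \<in> Qn \<longrightarrow> eff y z t \<le> 0) \<and>
     (\<forall>p. p \<notin> Qn \<longrightarrow> prob_eff T P y z p \<le> 0)"

definition maximal_solution_II ::
  "'q set \<Rightarrow> ('q, 'd::finite) trans set \<Rightarrow> (('q, 'd) trans \<Rightarrow> real) \<Rightarrow>
   ('d \<Rightarrow> int) \<Rightarrow> ('q \<Rightarrow> int) \<Rightarrow> bool" where
  "maximal_solution_II Qn T P y z \<longleftrightarrow>
     is_solution_II Qn T P y z \<and>
     (\<forall>c. (\<exists>y' z'. is_solution_II Qn T P y' z' \<and> y' c > 0) \<longrightarrow> y c > 0) \<and>
     (\<forall>t\<in>T. src t \<in> Qn \<longrightarrow>
        (\<exists>y' z'. is_solution_II Qn T P y' z' \<and> eff y' z' t < 0) \<longrightarrow> eff y z t < 0) \<and>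
     (\<forall>p. p \<notin> Qn \<longrightarrow>
        (\<exists>y' z'. is_solution_II Qn T P y' z' \<and> prob_eff T P y' z' p < 0) \<longrightarrow> prob_eff T P y z p < 0)"

end

theory Submission
  imports Defs "HOL-Real_Asymp.Real_Asymp"
begin

text \<open>If \<open>y c > 0\<close>, then \<open>z + y \<bullet> v\<close>, run until a counter becomes negative, is a nonnegative
  supermartingale of initial value \<open>O(n)\<close> that dominates the counter \<open>c\<close>, and Ville's inequality
  gives the upper estimate.

  If \<open>y c = 0\<close>, Farkas' lemma turns maximality into a nonnegative flow on the transitions, compatible
  with the probabilities, whose total effect is nonnegative on every counter and positive on \<open>c\<close>. The
  support of the flow splits into strongly connected components; strong connectivity of the whole graph
  extends each of them to a memoryless strategy with a single recurrent class, hence with a constant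
  gain vector. The single gains may be negative in some counters, but their weighted sum is not. The
  strategy plays them in turn, according to the clock alone, in time slots of length
  \<open>n powr (1 - e/2)\<close>, for \<open>n powr (2 - e)\<close> steps. By the Poisson equation, a counter deviates from
  its accumulated gain by a bounded amount per slot plus a martingale of size
  \<open>O(n powr (1 - e/2))\<close>, so no counter becomes negative, while \<open>c\<close> grows linearly in time.
  Switching by the clock matters: randomly timed switches would cause fluctuations larger than \<open>n\<close>.\<close>

subsection \<open>The path measure and Ville's inequality\<close>

lemma space_path_space [simp]: "space path_space = UNIV"
  by (simp add: path_space_def space_PiM)

lemma
  assumes "is_path_measure Qn T P \<sigma> p M"
  shows sets_path_measure: "sets M = sets path_space"
    and space_path_measure: "space M = UNIV"
    and prob_space_path_measure: "prob_space M"
proof -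
  show 1: "sets M = sets path_space" and "prob_space M"
    using assms by (auto simp: is_path_measure_def)
  from sets_eq_imp_space_eq[OF 1] show "space M = UNIV" by simp
qed

definition run_prefix :: "(nat \<Rightarrow> 'a) \<Rightarrow> nat \<Rightarrow> 'a list" where
  "run_prefix \<omega> n = map \<omega> [0..<n]"

lemma length_run_prefix [simp]: "length (run_prefix \<omega> n) = n"
  by (simp add: run_prefix_def)

lemma nth_run_prefix [simp]: "i < n \<Longrightarrow> run_prefix \<omega> n ! i = \<omega> i"
  by (simp add: run_prefix_def)

lemma run_prefix_0 [simp]: "run_prefix \<omega> 0 = []"
  by (simp add: run_prefix_def)

lemma run_prefix_Suc: "run_prefix \<omega> (Suc n) = run_prefix \<omega> n @ [\<omega> n]"
  by (simp add: run_prefix_def)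

lemma take_run_prefix: "i \<le> n \<Longrightarrow> take i (run_prefix \<omega> n) = run_prefix \<omega> i"
  by (simp add: run_prefix_def take_map)

lemma run_prefix_eq_iff: "run_prefix \<omega> (length ts) = ts \<longleftrightarrow> (\<forall>i<length ts. \<omega> i = ts ! i)"
  by (auto simp: list_eq_iff_nth_eq)

definition cylinder :: "'a list \<Rightarrow> (nat \<Rightarrow> 'a) set" where
  "cylinder ts = {\<omega>. \<forall>i<length ts. \<omega> i = ts ! i}"

lemma cylinder_iff: "\<omega> \<in> cylinder ts \<longleftrightarrow> run_prefix \<omega> (length ts) = ts"
  by (simp add: cylinder_def run_prefix_eq_iff)

text \<open>Lists of transitions form a countable type, so every predicate of a finite prefix is an
  event. Nearly all measurability questions below reduce to this.\<close>

lemma measurable_run_prefix: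
  "(\<lambda>\<omega>. run_prefix \<omega> n) \<in> measurable (path_space :: (nat \<Rightarrow> ('q::countable, 'd::finite) trans) measure) (count_space UNIV)"
proof (induction n)
  case (Suc n)
  have [measurable]: "(\<lambda>\<omega>. \<omega> n) \<in> measurable path_space (count_space UNIV)" for n
    unfolding path_space_def by measurable
  show ?case
    unfolding run_prefix_Suc
    using Suc by measurable
qed simp

text \<open>Draw one transition independently for every finite history and follow the draws.\<close>

lemma ex_measure_cylinder:
  fixes \<kappa> :: "('q::countable, 'd::finite) trans list \<Rightarrow> ('q, 'd) trans pmf"
  shows "\<exists>M. sets M = sets path_space \<and> prob_space M \<and>
    (\<forall>ts. emeasure M (cylinder ts) = ennreal (\<Prod>i<length ts. pmf (\<kappa> (take i ts)) (ts ! i)))"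
proof -
  let ?M = "\<lambda>ts. measure_pmf (\<kappa> ts)"
  interpret product_prob_space ?M "UNIV :: ('q,'d) trans list set"
    by (intro product_prob_spaceI) (simp add: measure_pmf.prob_space_axioms)
  let ?D = "PiM UNIV ?M"
  \<comment> \<open>\<open>X ts\<close> is the transition drawn at the history \<open>ts\<close>,
    and \<open>w X n\<close> is the history of length \<open>n\<close> obtained by always following
    the draws \<open>X\<close>.\<close>
  define w where "w X = rec_nat [] (\<lambda>_ ts. ts @ [X ts])" for X :: "('q,'d) trans list \<Rightarrow> ('q,'d) trans"
  have w0: "w X 0 = []" and wS: "w X (Suc n) = w X n @ [X (w X n)]" for X n
    by (simp_all add: w_def)
  have comp [measurable]: "(\<lambda>X. X ts) \<in> measurable ?D (count_space UNIV)" for ts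
    using measurable_component_singleton[of ts UNIV ?M] by (simp cong: measurable_cong_sets)
  have mw [measurable]: "(\<lambda>X. w X n) \<in> measurable ?D (count_space UNIV)" for n
  proof (induction n)
    case 0
    then show ?case by (simp add: w0)
  next
    case (Suc n)
    have "(\<lambda>X. X (w X n)) \<in> measurable ?D (count_space UNIV)"
      by (rule measurable_compose_countable[OF comp Suc])
    with Suc show ?case unfolding wS by measurable
  qed
  define path where "path X n = X (w X n)" for X n
  have mpath: "path \<in> measurable ?D path_space"
    unfolding path_space_def path_def
    by (rule measurable_PiM_single') (auto intro: measurable_compose_countable[OF comp mw])
  have wp: "w X n = run_prefix (path X) n" for X n
    by (induction n) (auto simp: w0 wS run_prefix_Suc path_def)
  let ?L = "distr ?D path_space path"
  show ?thesis
  proof (intro exI[of _ ?L] conjI allI)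
    show "prob_space ?L"
      by (intro prob_space.prob_space_distr mpath prob_space_axioms)
    fix ts :: "('q,'d) trans list"
    \<comment> \<open>Membership in the cylinder of \<open>ts\<close> reads only the coordinates at
      the proper prefixes of \<open>ts\<close>. These are pairwise distinct, so the draws there are
      independent and the probabilities multiply.\<close>
    let ?J = "(\<lambda>i. take i ts) ` {..<length ts}"
    have inj: "inj_on (\<lambda>i. take i ts) {..<length ts}"
      by (auto intro!: inj_onI dest!: arg_cong[of _ _ length])
    define A where "A us = {ts ! length us}" for us :: "('q,'d) trans list"
    have "path X \<in> cylinder ts \<longleftrightarrow> (\<forall>i<length ts. X (take i ts) = ts ! i)" for X
    proof
      assume *: "path X \<in> cylinder ts"
      then have "run_prefix (path X) i = take i ts" if "i < length ts" for i
        using take_run_prefix[of i "length ts" "path X"] that by (simp add: cylinder_iff)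
      with * show "\<forall>i<length ts. X (take i ts) = ts ! i"
        by (auto simp: cylinder_def path_def wp)
    next
      assume *: "\<forall>i<length ts. X (take i ts) = ts ! i"
      have "i \<le> length ts \<Longrightarrow> w X i = take i ts" for i
        by (induction i) (use * in \<open>auto simp: w0 wS take_Suc_conv_app_nth\<close>)
      with * show "path X \<in> cylinder ts"
        by (auto simp: cylinder_def path_def)
    qed
    then have eq: "path -` cylinder ts \<inter> space ?D = emb UNIV ?J (Pi\<^sub>E ?J A)"
      by (auto simp: prod_emb_def space_PiM A_def PiE_iff)
    have "{\<omega>\<in>space path_space. run_prefix \<omega> (length ts) = ts} \<in> sets path_space"
      using measurable_run_prefix[of "length ts"] by measurable
    then have cyl: "cylinder ts \<in> sets path_space"
      by (simp add: cylinder_iff[symmetric] Collect_mem_eq)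
    have "emeasure ?L (cylinder ts) = emeasure ?D (emb UNIV ?J (Pi\<^sub>E ?J A))"
      by (simp add: emeasure_distr[OF mpath cyl] eq)
    also have "\<dots> = (\<Prod>us\<in>?J. emeasure (?M us) (A us))"
      by (intro emeasure_PiM_emb) auto
    also have "\<dots> = (\<Prod>i<length ts. ennreal (pmf (\<kappa> (take i ts)) (ts ! i)))"
      by (subst prod.reindex[OF inj]) (auto simp: A_def emeasure_pmf_single intro!: prod.cong)
    also have "\<dots> = ennreal (\<Prod>i<length ts. pmf (\<kappa> (take i ts)) (ts ! i))"
      by (rule prod_ennreal) simp
    finally show "emeasure ?L (cylinder ts) = ennreal (\<Prod>i<length ts. pmf (\<kappa> (take i ts)) (ts ! i))" .
  qed simp
qed

lemma finite_Out: "vass_mdp Qn T P \<Longrightarrow> finite (Out T p)"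
  by (simp add: vass_mdp_def Out_def)

lemma ex_pmf_finite:
  assumes "finite A" "\<And>t. t \<in> A \<Longrightarrow> f t \<ge> 0" "(\<Sum>t\<in>A. f t) = 1"
  shows "\<exists>k. \<forall>t. pmf k t = (if t \<in> A then f t else 0)"
proof -
  have "(\<integral>\<^sup>+ t. ennreal (if t \<in> A then f t else 0) \<partial>count_space UNIV) = 1"
    using assms by (subst nn_integral_count_space'[OF assms(1)]) (auto simp: sum_ennreal)
  then have "pmf (embed_pmf (\<lambda>t. if t \<in> A then f t else 0)) t = (if t \<in> A then f t else 0)" for t
    by (subst pmf_embed_pmf) (auto simp: assms)
  then show ?thesis by blast
qed

lemma ex_pmf_transition:
  assumes "vass_mdp Qn T P" "p \<notin> Qn"
  shows "\<exists>k. \<forall>t. pmf k t = (if t \<in> Out T p then P t else 0)"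
  using assms finite_Out[OF assms(1)]
  by (intro ex_pmf_finite) (auto simp: vass_mdp_def less_imp_le)

text \<open>The existence of a measure with these cylinder values is what makes the choice in
  \<open>path_measure\<close> meaningful. The kernel is \<open>\<sigma>\<close> at nondeterministic
  states and \<open>P\<close> at the others.\<close>

lemma is_path_measure_path_measure:
  fixes T :: "('q::finite, 'd::finite) trans set"
  assumes "vass_mdp Qn T P"
  shows "is_path_measure Qn T P \<sigma> p (path_measure Qn T P \<sigma> p)"
proof -
  have "\<exists>k. \<forall>t. pmf k t = next_prob Qn T P \<sigma> h t" for h
    using ex_pmf_transition[OF assms] by (cases "last_state h \<in> Qn") (auto simp: next_prob_def)
  then obtain \<kappa> where \<kappa>: "\<And>h t. pmf (\<kappa> h) t = next_prob Qn T P \<sigma> h t"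
    by metis
  from ex_measure_cylinder[of "\<lambda>ts. \<kappa> (p, ts)"] obtain M where
    M: "sets M = sets path_space" "prob_space M"
      "\<And>ts. emeasure M (cylinder ts) = ennreal (\<Prod>i<length ts. pmf (\<kappa> (p, take i ts)) (ts ! i))"
    by blast
  from sets_eq_imp_space_eq[OF M(1)] have "space M = UNIV" by simp
  then have "is_path_measure Qn T P \<sigma> p M"
    using M unfolding is_path_measure_def by (auto simp: cylinder_def \<kappa>)
  then show ?thesis
    unfolding path_measure_def by (rule someI)
qed

text \<open>The conditional expectation of a function of the next transition, given the finite path
  \<open>h\<close>. As a finite sum it allows supermartingales to be plain functions of finite
  histories, without filtrations.\<close>

definition step_mean ::
  "'q set \<Rightarrow> ('q, 'd) trans set \<Rightarrow> (('q, 'd) trans \<Rightarrow> real) \<Rightarrow>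
   (('q, 'd) hist \<Rightarrow> ('q, 'd) trans pmf) \<Rightarrow> ('q, 'd) hist \<Rightarrow> (('q, 'd) trans \<Rightarrow> real) \<Rightarrow> real" where
  "step_mean Qn T P \<sigma> h f = (\<Sum>t\<in>Out T (last_state h). next_prob Qn T P \<sigma> h t * f t)"

lemma next_prob_nonneg: "vass_mdp Qn T P \<Longrightarrow> next_prob Qn T P \<sigma> h t \<ge> 0"
  by (auto simp: next_prob_def vass_mdp_def less_imp_le)

lemma sum_next_prob:
  fixes T :: "('q::finite, 'd::finite) trans set"
  assumes "vass_mdp Qn T P" "is_strategy Qn T \<sigma>"
  shows "(\<Sum>t\<in>Out T (last_state h). next_prob Qn T P \<sigma> h t) = 1"
proof (cases "last_state h \<in> Qn")
  case True
  with assms(2) have "set_pmf (\<sigma> h) \<subseteq> Out T (last_state h)"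
    unfolding is_strategy_def by blast
  with True finite_Out[OF assms(1)] show ?thesis
    by (simp add: next_prob_def sum_pmf_eq_1)
next
  case False
  with assms(1) show ?thesis
    by (simp add: next_prob_def vass_mdp_def)
qed

lemma step_mean_const:
  fixes T :: "('q::finite, 'd::finite) trans set"
  assumes "vass_mdp Qn T P" "is_strategy Qn T \<sigma>"
  shows "step_mean Qn T P \<sigma> h (\<lambda>_. a) = a"
  using sum_next_prob[OF assms] by (simp add: step_mean_def flip: sum_distrib_right)

lemma step_mean_add:
  "step_mean Qn T P \<sigma> h (\<lambda>t. f t + g t) = step_mean Qn T P \<sigma> h f + step_mean Qn T P \<sigma> h g"
  by (simp add: step_mean_def sum.distrib distrib_left)

lemma step_mean_cmult:
  "step_mean Qn T P \<sigma> h (\<lambda>t. a * f t) = a * step_mean Qn T P \<sigma> h f"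
  by (simp add: step_mean_def sum_distrib_left mult_ac)

lemma step_mean_sum:
  "step_mean Qn T P \<sigma> h (\<lambda>t. \<Sum>i\<in>I. f i t) = (\<Sum>i\<in>I. step_mean Qn T P \<sigma> h (f i))"
  unfolding step_mean_def sum_distrib_left by (rule sum.swap)

lemma step_mean_mono:
  assumes "vass_mdp Qn T P" "\<And>t. t \<in> Out T (last_state h) \<Longrightarrow> f t \<le> g t"
  shows "step_mean Qn T P \<sigma> h f \<le> step_mean Qn T P \<sigma> h g"
  unfolding step_mean_def by (intro sum_mono mult_left_mono assms next_prob_nonneg)

lemma measurable_run_prefix_Collect:
  fixes M :: "(nat \<Rightarrow> ('q::finite, 'd::finite) trans) measure"
  assumes "sets M = sets path_space"
  shows "{\<omega>. Q (run_prefix \<omega> n)} \<in> sets M"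
proof -
  have "{\<omega>\<in>space path_space. Q (run_prefix \<omega> n)} \<in> sets path_space"
    using measurable_run_prefix[of n] by measurable
  then show ?thesis by (simp add: assms)
qed

text \<open>Ville's inequality with horizon \<open>N\<close>, localized to a cylinder of probability
  \<open>\<mu> ts\<close>, by induction on the number \<open>k\<close> of remaining steps. If
  \<open>\<Phi> ts\<close> has reached \<open>K\<close>, the probability of the whole cylinder
  suffices as a bound; otherwise the cylinder is split by the next transition and the
  supermartingale property averages the bounds of the pieces.\<close>

lemma path_measure_maximal_aux:
  fixes T :: "('q::finite, 'd::finite) trans set" and \<Phi> :: "('q, 'd) trans list \<Rightarrow> real"
  assumes A: "vass_mdp Qn T P" "is_strategy Qn T \<sigma>" and M: "is_path_measure Qn T P \<sigma> p M"
    and nn: "\<And>ts. length ts \<le> N \<Longrightarrow> \<Phi> ts \<ge> 0"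
    and super: "\<And>ts. length ts < N \<Longrightarrow> step_mean Qn T P \<sigma> (p, ts) (\<lambda>t. \<Phi> (ts @ [t])) \<le> \<Phi> ts"
    and K: "K > 0"
  defines "\<mu> \<equiv> \<lambda>ts. \<Prod>i<length ts. next_prob Qn T P \<sigma> (p, take i ts) (ts ! i)"
  shows "length ts + k = N \<Longrightarrow>
    measure M {\<omega>\<in>cylinder ts. \<exists>i\<in>{length ts..N}. K \<le> \<Phi> (run_prefix \<omega> i)} \<le> \<mu> ts * (\<Phi> ts / K)"
proof (induction k arbitrary: ts)
  interpret prob_space M using prob_space_path_measure[OF M] .
  have \<mu>_nn: "\<mu> ts \<ge> 0" for ts
    unfolding \<mu>_def by (intro prod_nonneg) (simp add: next_prob_nonneg[OF A(1)])
  have m\<mu>: "measure M (cylinder ts) = \<mu> ts" for ts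
    using M space_path_measure[OF M] \<mu>_nn[of ts]
    by (simp add: is_path_measure_def cylinder_def \<mu>_def measure_def)
  have sets_cyl: "cylinder ts \<in> sets M" for ts
    using measurable_run_prefix_Collect[OF sets_path_measure[OF M], of "\<lambda>us. us = ts" "length ts"]
    by (simp add: cylinder_iff[symmetric] Collect_mem_eq)
  have sets_ev: "{\<omega>. \<exists>i\<in>{m..N}. K \<le> \<Phi> (run_prefix \<omega> i)} \<in> sets M" for m
  proof -
    have "{\<omega>. \<exists>i\<in>{m..N}. K \<le> \<Phi> (run_prefix \<omega> i)} = (\<Union>i\<in>{m..N}. {\<omega>. K \<le> \<Phi> (run_prefix \<omega> i)})" by auto
    also have "\<dots> \<in> sets M"
      by (intro sets.finite_UN measurable_run_prefix_Collect[OF sets_path_measure[OF M]]) auto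
    finally show ?thesis .
  qed
  have sets_E: "{\<omega>\<in>cylinder ts. \<exists>i\<in>{m..N}. K \<le> \<Phi> (run_prefix \<omega> i)} \<in> sets M" for ts m
    using sets.Int[OF sets_cyl sets_ev] by (simp add: Int_def)
  have big: "measure M {\<omega>\<in>cylinder ts. \<exists>i\<in>{length ts..N}. K \<le> \<Phi> (run_prefix \<omega> i)} \<le> \<mu> ts * (\<Phi> ts / K)"
    if "K \<le> \<Phi> ts" for ts
  proof -
    have "measure M {\<omega>\<in>cylinder ts. \<exists>i\<in>{length ts..N}. K \<le> \<Phi> (run_prefix \<omega> i)} \<le> measure M (cylinder ts)"
      by (intro finite_measure_mono sets_cyl) auto
    also have "\<dots> \<le> \<mu> ts * (\<Phi> ts / K)"
      using that K \<mu>_nn[of ts] by (simp add: m\<mu> field_simps mult_right_mono)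
    finally show ?thesis .
  qed
  {
    case 0
    show ?case
    proof (cases "K \<le> \<Phi> ts")
      case False
      with 0 have eq: "{\<omega>\<in>cylinder ts. \<exists>i\<in>{length ts..N}. K \<le> \<Phi> (run_prefix \<omega> i)} = {}"
        by (auto simp: cylinder_iff)
      show ?thesis
        unfolding eq using \<mu>_nn[of ts] nn[of ts] 0 K by simp
    qed (rule big)
  next
    case (Suc k)
    show ?case
    proof (cases "K \<le> \<Phi> ts")
      case False
      define Ts where "Ts = Out T (last_state (p, ts))"
      have finTs: "finite Ts" unfolding Ts_def using finite_Out[OF A(1)] .
      have \<mu>S: "\<mu> (ts @ [t]) = \<mu> ts * next_prob Qn T P \<sigma> (p, ts) t" for t
        by (simp add: \<mu>_def lessThan_Suc nth_append mult.commute)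
      let ?E = "\<lambda>ts. {\<omega>\<in>cylinder ts. \<exists>i\<in>{length ts..N}. K \<le> \<Phi> (run_prefix \<omega> i)}"
      \<comment> \<open>The paths that continue with a transition outside \<open>Ts\<close>. They
        form a null set, because the probabilities over \<open>Ts\<close> sum to one.\<close>
      let ?C = "cylinder ts - (\<Union>t\<in>Ts. cylinder (ts @ [t]))"
      have cyl_app: "\<omega> \<in> cylinder (ts @ [t]) \<longleftrightarrow> \<omega> \<in> cylinder ts \<and> \<omega> (length ts) = t" for \<omega> t
        by (auto simp: cylinder_iff run_prefix_Suc)
      have disj: "disjoint_family_on (\<lambda>t. cylinder (ts @ [t])) Ts"
        by (auto simp: disjoint_family_on_def cyl_app)
      have "measure M (\<Union>t\<in>Ts. cylinder (ts @ [t])) = (\<Sum>t\<in>Ts. \<mu> (ts @ [t]))"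
        using finTs disj sets_cyl by (subst finite_measure_finite_Union) (auto simp: m\<mu>)
      also have "\<dots> = \<mu> ts"
        unfolding \<mu>S Ts_def by (simp add: sum_next_prob[OF A] flip: sum_distrib_left)
      finally have "measure M ?C = 0"
        by (subst finite_measure_Diff) (auto simp: sets_cyl m\<mu> finTs cyl_app)
      have "?E ts \<subseteq> (\<Union>t\<in>Ts. ?E (ts @ [t])) \<union> ?C"
      proof
        fix \<omega> assume *: "\<omega> \<in> ?E ts"
        then obtain i where i: "length ts \<le> i" "i \<le> N" "K \<le> \<Phi> (run_prefix \<omega> i)" by auto
        from * False have "i \<noteq> length ts"
          using i by (auto simp: cylinder_iff)
        with i have "length ts + 1 \<le> i" by simp
        with * i show "\<omega> \<in> (\<Union>t\<in>Ts. ?E (ts @ [t])) \<union> ?C"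
          by (auto simp: cyl_app)
      qed
      then have "measure M (?E ts) \<le> measure M ((\<Union>t\<in>Ts. ?E (ts @ [t])) \<union> ?C)"
        using finTs sets_cyl sets_E by (intro finite_measure_mono) (auto intro!: sets.finite_UN)
      also have "\<dots> \<le> measure M (\<Union>t\<in>Ts. ?E (ts @ [t])) + measure M ?C"
        using finTs sets_cyl sets_E by (intro measure_Un_le sets.Diff sets.finite_UN) auto
      also have "\<dots> \<le> (\<Sum>t\<in>Ts. measure M (?E (ts @ [t])))"
        using \<open>measure M ?C = 0\<close> finTs sets_E
        by (simp del: length_append) (intro measure_UNION_le, auto)
      also have "\<dots> \<le> (\<Sum>t\<in>Ts. \<mu> (ts @ [t]) * (\<Phi> (ts @ [t]) / K))"
        using Suc.prems by (intro sum_mono Suc.IH) simp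
      also have "\<dots> = \<mu> ts * (step_mean Qn T P \<sigma> (p, ts) (\<lambda>t. \<Phi> (ts @ [t])) / K)"
        by (simp add: \<mu>S step_mean_def Ts_def sum_distrib_left sum_divide_distrib mult_ac)
      also have "\<dots> \<le> \<mu> ts * (\<Phi> ts / K)"
        using Suc.prems K by (intro mult_left_mono divide_right_mono super \<mu>_nn) auto
      finally show ?thesis .
    qed (rule big)
  }
qed

lemma path_measure_maximal:
  fixes T :: "('q::finite, 'd::finite) trans set" and \<Phi> :: "('q, 'd) trans list \<Rightarrow> real"
  assumes "vass_mdp Qn T P" "is_strategy Qn T \<sigma>" "is_path_measure Qn T P \<sigma> p M"
    and "\<And>ts. length ts \<le> N \<Longrightarrow> \<Phi> ts \<ge> 0"
    and "\<And>ts. length ts < N \<Longrightarrow> step_mean Qn T P \<sigma> (p, ts) (\<lambda>t. \<Phi> (ts @ [t])) \<le> \<Phi> ts"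
    and "K > 0"
  shows "measure M {\<omega>. \<exists>i\<le>N. K \<le> \<Phi> (run_prefix \<omega> i)} \<le> \<Phi> [] / K"
  using path_measure_maximal_aux[OF assms, where ts = "[]" and k = N]
  by (simp add: cylinder_def Bex_def)

subsection \<open>Farkas' lemma and flows\<close>

declare split_paired_All [simp del] split_paired_Ex [simp del]

definition dot :: "('v::finite \<Rightarrow> 'f::linordered_field) \<Rightarrow> ('v \<Rightarrow> 'f) \<Rightarrow> 'f" where
  "dot u v = (\<Sum>i\<in>UNIV. u i * v i)"

lemma dot_diff_right: "dot u (\<lambda>i. v i - s * w i) = dot u v - s * dot u w"
  by (simp add: dot_def algebra_simps sum_subtractf sum_distrib_left)

lemma dot_diff_left: "dot (\<lambda>i. v i - s * w i) u = dot v u - s * dot w u"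
  by (simp add: dot_def algebra_simps sum_subtractf sum_distrib_left)

lemma dot_sum_right: "dot u (\<lambda>i. \<Sum>k\<in>K. l k * a k i) = (\<Sum>k\<in>K. l k * dot u (a k))"
  unfolding dot_def sum_distrib_left
  by (subst sum.swap) (simp add: mult_ac)

text \<open>Farkas' lemma over an arbitrary ordered field, by induction on the number of generators: if
  the certificate \<open>w\<close> for the old generators violates the new one, project along the new generator
  onto the hyperplane orthogonal to \<open>w\<close>.\<close>

lemma farkas:
  fixes a :: "'k \<Rightarrow> 'v::finite \<Rightarrow> 'f::linordered_field"
  assumes "finite K"
  shows "(\<exists>l. (\<forall>k\<in>K. l k \<ge> 0) \<and> (\<forall>v. b v = (\<Sum>k\<in>K. l k * a k v))) \<or>
    (\<exists>w. (\<forall>k\<in>K. dot w (a k) \<le> 0) \<and> dot w b > 0)"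
  using assms
proof (induction K arbitrary: a b rule: finite_induct)
  case empty
  show ?case
  proof (cases "\<forall>v. b v = 0")
    case False
    then obtain v where "b v \<noteq> 0" by blast
    then have "b v * b v > 0" by (auto simp: zero_less_mult_iff neq_iff)
    then have "dot b b > 0"
      unfolding dot_def by (intro sum_pos2[of _ v]) auto
    then show ?thesis by auto
  qed auto
next
  case (insert n K)
  show ?case
  proof (cases "\<exists>l. (\<forall>k\<in>K. l k \<ge> 0) \<and> (\<forall>v. b v = (\<Sum>k\<in>K. l k * a k v))")
    case True
    then obtain l where l: "\<forall>k\<in>K. l k \<ge> 0" "\<forall>v. b v = (\<Sum>k\<in>K. l k * a k v)" by blast
    have "(\<Sum>k\<in>K. (l(n := 0)) k * a k v) = (\<Sum>k\<in>K. l k * a k v)" for v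
      using insert.hyps by (intro sum.cong) auto
    then show ?thesis
      using l insert.hyps by (intro disjI1 exI[of _ "l(n := 0)"]) auto
  next
    case False
    with insert.IH[of b a] obtain w where w: "\<forall>k\<in>K. dot w (a k) \<le> 0" "dot w b > 0" by blast
    show ?thesis
    proof (cases "dot w (a n) \<le> 0")
      case True
      with w show ?thesis by auto
    next
      case False
      \<comment> \<open>\<open>s v\<close> is the coefficient for which \<open>pr v\<close> is
        orthogonal to \<open>w\<close>.\<close>
      define s where "s v = dot w v / dot w (a n)" for v
      define pr where "pr v = (\<lambda>i. v i - s v * a n i)" for v
      from insert.IH[of "pr b" "\<lambda>k. pr (a k)"] show ?thesis
      proof (elim disjE exE conjE)
        fix l assume l: "\<forall>k\<in>K. l k \<ge> 0" "\<forall>v. pr b v = (\<Sum>k\<in>K. l k * pr (a k) v)"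
        \<comment> \<open>Undoing the projection leaves this coefficient for the new generator. It
          is nonnegative because \<open>w\<close> is positive on \<open>b\<close> and on
          \<open>a n\<close> but nonpositive on the old generators.\<close>
        define m where "m = s b - (\<Sum>k\<in>K. l k * s (a k))"
        have "s b \<ge> 0" and "\<And>k. k \<in> K \<Longrightarrow> s (a k) \<le> 0"
          using w False by (auto simp: s_def divide_le_0_iff)
        then have "m \<ge> 0"
          using l(1) sum_nonpos[of K "\<lambda>k. l k * s (a k)"] by (simp add: m_def mult_nonneg_nonpos)
        moreover have "b v = m * a n v + (\<Sum>k\<in>K. l k * a k v)" for v
          using l(2)[rule_format, of v]
          by (simp add: pr_def m_def algebra_simps sum_subtractf sum_distrib_left)
        moreover have "(\<Sum>k\<in>K. (l(n := m)) k * a k v) = (\<Sum>k\<in>K. l k * a k v)" for v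
          using insert.hyps by (intro sum.cong) auto
        ultimately show ?thesis
          using l insert.hyps by (intro disjI1 exI[of _ "l(n := m)"]) auto
      next
        fix u assume u: "\<forall>k\<in>K. dot u (pr (a k)) \<le> 0" "dot u (pr b) > 0"
        \<comment> \<open>The adjoint of the projection applied to \<open>u\<close>, so that
          \<open>u'\<close> acts on \<open>v\<close> as \<open>u\<close> acts on
          \<open>pr v\<close>; in particular it annihilates \<open>a n\<close>.\<close>
        define u' where "u' = (\<lambda>i. u i - (dot u (a n) / dot w (a n)) * w i)"
        have "dot u' v = dot u (pr v)" for v
          unfolding u'_def pr_def s_def dot_diff_left dot_diff_right by simp
        moreover have "dot u (pr (a n)) = 0"
          unfolding pr_def s_def dot_diff_right using False by simp
        ultimately show ?thesis
          using u by (intro disjI2 exI[of _ u']) auto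
      qed
    qed
  qed
qed

text \<open>Serves twice: it turns a rational certificate into an integer solution of (II), and it
  scales a rational flow to one with natural outflows.\<close>

lemma common_denominator:
  fixes f :: "'a \<Rightarrow> rat"
  assumes "finite A"
  shows "\<exists>m::nat. m > 0 \<and> (\<forall>a\<in>A. of_nat m * f a \<in> \<int>)"
  using assms
proof (induction rule: finite_induct)
  case empty
  then show ?case by (auto intro: exI[of _ 1])
next
  case (insert a A)
  then obtain m where m: "m > 0" "\<forall>a\<in>A. of_nat m * f a \<in> \<int>" by blast
  obtain i j where ij: "f a = Fract i j" "j > 0" by (cases "f a") auto
  have "of_nat (nat j) * f a = of_int i"
    using ij by (simp add: Fract_of_int_quotient)
  moreover have "of_nat (m * nat j) * f b = of_nat m * (of_nat (nat j) * f b)"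
    "of_nat (m * nat j) * f b = of_nat (nat j) * (of_nat m * f b)" for b
    by simp_all
  ultimately show ?case
    using m ij by (intro exI[of _ "m * nat j"]) (metis Ints_mult Ints_of_int Ints_of_nat
        insert_iff mult_pos_pos zero_less_nat_eq)
qed

lemma sum_Out:
  fixes A :: "'q::finite set"
  assumes "finite T"
  shows "(\<Sum>p\<in>A. \<Sum>t\<in>Out T p. f t) = (\<Sum>t\<in>{t\<in>T. src t \<in> A}. f t)"
proof -
  have "{t \<in> {t\<in>T. src t \<in> A}. src t = p} = Out T p" if "p \<in> A" for p
    using that by (auto simp: Out_def)
  then show ?thesis
    using assms sum.group[of "{t\<in>T. src t \<in> A}" A src f] by auto
qed

lemma sum_In:
  fixes A :: "'q::finite set"
  assumes "finite T"
  shows "(\<Sum>p\<in>A. \<Sum>t\<in>In T p. f t) = (\<Sum>t\<in>{t\<in>T. tgt t \<in> A}. f t)"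
proof -
  have "{t \<in> {t\<in>T. tgt t \<in> A}. tgt t = p} = In T p" if "p \<in> A" for p
    using that by (auto simp: In_def)
  then show ?thesis
    using assms sum.group[of "{t\<in>T. tgt t \<in> A}" A tgt f] by auto
qed

section \<open>Flows and duality for system (II)\<close>

definition outflow :: "('q, 'd) trans set \<Rightarrow> (('q, 'd) trans \<Rightarrow> 'a::comm_monoid_add) \<Rightarrow> 'q \<Rightarrow> 'a" where
  "outflow T x p = (\<Sum>t\<in>Out T p. x t)"

text \<open>The dual of (II), without its constraints on the effect of \<open>x\<close> on the counters.\<close>

definition mdp_flow ::
  "'q set \<Rightarrow> ('q, 'd) trans set \<Rightarrow> (('q, 'd) trans \<Rightarrow> real) \<Rightarrow> (('q, 'd) trans \<Rightarrow> real) \<Rightarrow> bool" where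
  "mdp_flow Qn T P x \<longleftrightarrow>
     (\<forall>t\<in>T. x t \<ge> 0) \<and>
     (\<forall>q. outflow T x q = (\<Sum>t\<in>In T q. x t)) \<and>
     (\<forall>p t. p \<notin> Qn \<longrightarrow> t \<in> Out T p \<longrightarrow> x t = P t * outflow T x p)"

text \<open>The coefficients of \<open>eff y z t\<close> as a linear form in \<open>y\<close> (left
  summand) and \<open>z\<close> (right summand). Read dually, a combination of these vectors
  collects the total effect on each counter and the inflow minus outflow of each state.\<close>

definition trans_vec :: "('q, 'd) trans \<Rightarrow> 'd + 'q \<Rightarrow> 'f::linordered_field" where
  "trans_vec t v = (case v of Inl i \<Rightarrow> of_int (upd t i)
     | Inr q \<Rightarrow> (if tgt t = q then 1 else 0) - (if src t = q then 1 else 0))"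

lemma sum_UNIV_Plus:
  fixes f :: "'a::finite + 'b::finite \<Rightarrow> 'c::comm_monoid_add"
  shows "(\<Sum>v\<in>UNIV. f v) = (\<Sum>i\<in>UNIV. f (Inl i)) + (\<Sum>q\<in>UNIV. f (Inr q))"
  using sum.Plus[of UNIV UNIV f] by (simp add: UNIV_Plus_UNIV comp_def)

lemma dot_trans_vec:
  fixes w :: "'d::finite + 'q::finite \<Rightarrow> 'f::linordered_field"
  shows "dot w (trans_vec t) =
    (\<Sum>i\<in>UNIV. w (Inl i) * of_int (upd t i)) + w (Inr (tgt t)) - w (Inr (src t))"
proof -
  have "(\<Sum>q\<in>UNIV. w (Inr q) * ((if tgt t = q then 1 else 0) - (if src t = q then 1 else 0)))
      = w (Inr (tgt t)) - w (Inr (src t))"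
    by (simp add: right_diff_distrib sum_subtractf if_distrib[of "(*) _"] cong: if_cong)
  then show ?thesis
    by (simp add: dot_def sum_UNIV_Plus trans_vec_def)
qed

text \<open>Farkas' lemma is applied over the rationals, since (II) asks for integers and the
  probabilities are rational. A separating vector would scale to a solution with
  \<open>y c > 0\<close>, so the multipliers must exist, and they are the flow.\<close>

lemma no_positive_solution_imp_flow:
  fixes T :: "('q::finite, 'd::finite) trans set"
  assumes A: "vass_mdp Qn T P"
    and no: "\<not> (\<exists>y z. is_solution_II Qn T P y z \<and> y c > 0)"
  shows "\<exists>x. mdp_flow Qn T P x \<and> (\<forall>p. outflow T x p \<in> \<nat>) \<and>
    (\<forall>i. (\<Sum>t\<in>T. x t * upd t i) \<ge> 0) \<and> (\<Sum>t\<in>T. x t * upd t c) > 0"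
proof -
  have finT: "finite T" using A by (simp add: vass_mdp_def)
  have "\<exists>r. src t \<notin> Qn \<longrightarrow> t \<in> T \<longrightarrow> P t = of_rat r" for t
  proof -
    have "P t \<in> \<rat>" if "src t \<notin> Qn" "t \<in> T"
      using A that unfolding vass_mdp_def Out_def by blast
    then show ?thesis by (auto elim: Rats_cases)
  qed
  then obtain R where R: "\<And>t. src t \<notin> Qn \<Longrightarrow> t \<in> T \<Longrightarrow> P t = of_rat (R t)" by metis
  have R_Out: "P t = of_rat (R t)" if "p \<notin> Qn" "t \<in> Out T p" for p t
    using that R by (auto simp: Out_def)
  define K :: "('d + ('q, 'd) trans + 'q) set" where
    "K = UNIV <+> ({t\<in>T. src t \<in> Qn} <+> - Qn)"
  \<comment> \<open>The generators encode \<open>y \<ge> 0\<close>, the inequalities at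
    nondeterministic transitions and those at probabilistic states. There is none for
    \<open>z \<ge> 0\<close>: only differences of \<open>z\<close> enter the remaining inequalities,
    so \<open>z\<close> can be shifted afterwards.\<close>
  define a :: "'d + ('q, 'd) trans + 'q \<Rightarrow> 'd + 'q \<Rightarrow> rat" where
    "a k = (case k of Inl i \<Rightarrow> (\<lambda>v. if v = Inl i then - 1 else 0)
      | Inr (Inl t) \<Rightarrow> trans_vec t
      | Inr (Inr p) \<Rightarrow> (\<lambda>v. \<Sum>t\<in>Out T p. R t * trans_vec t v))" for k
  define b :: "'d + 'q \<Rightarrow> rat" where "b v = (if v = Inl c then 1 else 0)" for v
  have finK: "finite K" using finT by (auto simp: K_def)
  have sumK: "(\<Sum>k\<in>K. f k) = (\<Sum>i\<in>UNIV. f (Inl i)) + ((\<Sum>t\<in>{t\<in>T. src t \<in> Qn}. f (Inr (Inl t)))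
      + (\<Sum>p\<in>-Qn. f (Inr (Inr p))))" for f :: "_ \<Rightarrow> rat"
    unfolding K_def using finT by (subst sum.Plus, simp, simp, subst sum.Plus) (auto simp: comp_def)
  from farkas[OF finK, of b a] show ?thesis
  proof (elim disjE exE conjE)
    fix w assume w: "\<forall>k\<in>K. dot w (a k) \<le> 0" "dot w b > 0"
    from common_denominator[of UNIV w] obtain m where m: "m > 0" "\<And>v. of_nat m * w v \<in> \<int>" by auto
    define Z where "Z v = \<lfloor>of_nat m * w v\<rfloor>" for v
    have Z: "rat_of_int (Z v) = of_nat m * w v" for v
      using m(2)[of v] by (auto simp: Z_def elim!: Ints_cases)
    define y where "y i = Z (Inl i)" for i
    define z where "z q = Z (Inr q) - Min (range (\<lambda>q. Z (Inr q)))" for q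
    have eff: "rat_of_int (eff y z t) = of_nat m * dot w (trans_vec t)" for t
      by (simp add: eff_def z_def y_def Z dot_trans_vec ring_distribs sum_distrib_left mult_ac)
    have y: "y i \<ge> 0" for i
    proof -
      have "dot w (a (Inl i)) = - w (Inl i)"
        by (simp add: dot_def a_def if_distrib[of "(*) _"] cong: if_cong)
      with w(1) have "w (Inl i) \<ge> 0" by (auto simp: K_def dest!: bspec[of _ _ "Inl i"])
      then have "rat_of_int (y i) \<ge> 0" by (simp add: y_def Z)
      then show ?thesis by simp
    qed
    moreover have "z q \<ge> 0" for q by (simp add: z_def)
    moreover have "eff y z t \<le> 0" if "t \<in> T" "src t \<in> Qn" for t
    proof -
      have "Inr (Inl t) \<in> K" using that by (auto simp: K_def)
      with w(1) have "dot w (a (Inr (Inl t))) \<le> 0" by blast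
      then have "rat_of_int (eff y z t) \<le> 0" by (simp add: a_def eff mult_nonneg_nonpos)
      then show ?thesis by simp
    qed
    moreover have "prob_eff T P y z p \<le> 0" if "p \<notin> Qn" for p
    proof -
      have "Inr (Inr p) \<in> K" using that by (auto simp: K_def)
      with w(1) have "dot w (a (Inr (Inr p))) \<le> 0" by blast
      then have "(\<Sum>t\<in>Out T p. R t * dot w (trans_vec t)) \<le> 0" by (simp add: a_def dot_sum_right)
      then have "of_nat m * (\<Sum>t\<in>Out T p. R t * dot w (trans_vec t)) \<le> 0"
        by (simp add: mult_nonneg_nonpos)
      then have "(\<Sum>t\<in>Out T p. R t * rat_of_int (eff y z t)) \<le> 0"
        by (simp add: eff sum_distrib_left mult_ac)
      moreover have "prob_eff T P y z p = of_rat (\<Sum>t\<in>Out T p. R t * rat_of_int (eff y z t))"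
        using R_Out[OF that] by (simp add: prob_eff_def of_rat_sum of_rat_mult)
      ultimately show ?thesis by simp
    qed
    ultimately have "is_solution_II Qn T P y z" by (auto simp: is_solution_II_def)
    with no have "y c \<le> 0" by (meson not_less)
    moreover have "dot w b = w (Inl c)"
      by (simp add: dot_def b_def if_distrib[of "(*) _"] cong: if_cong)
    with w(2) m(1) have "rat_of_int (y c) > 0" by (simp add: y_def Z)
    ultimately show ?thesis by simp
  next
    fix l assume l: "\<forall>k\<in>K. l k \<ge> 0" "\<forall>v. b v = (\<Sum>k\<in>K. l k * a k v)"
    \<comment> \<open>The multiplier of a probabilistic state is distributed over its outgoing
      transitions according to their probabilities.\<close>
    define x where "x t = (if src t \<in> Qn then l (Inr (Inl t)) else l (Inr (Inr (src t))) * R t)" for t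
    have R_nn: "R t \<ge> 0" if "t \<in> T" "src t \<notin> Qn" for t
    proof -
      have "P t \<ge> 0" using A that unfolding vass_mdp_def Out_def by (blast intro: less_imp_le)
      with R[OF that(2,1)] show ?thesis by simp
    qed
    have x_nn: "x t \<ge> 0" if "t \<in> T" for t
    proof (cases "src t \<in> Qn")
      case True
      with that have "Inr (Inl t) \<in> K" by (auto simp: K_def)
      with True l(1) show ?thesis by (simp add: x_def)
    next
      case False
      then have "Inr (Inr (src t)) \<in> K" by (auto simp: K_def)
      with False l(1) R_nn[OF that] show ?thesis by (simp add: x_def)
    qed
    have eq: "b v = (\<Sum>i\<in>UNIV. l (Inl i) * a (Inl i) v) + (\<Sum>t\<in>T. x t * trans_vec t v)" for v
    proof -
      have "(\<Sum>p\<in>-Qn. l (Inr (Inr p)) * a (Inr (Inr p)) v)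
          = (\<Sum>p\<in>-Qn. \<Sum>t\<in>Out T p. x t * trans_vec t v)"
        by (intro sum.cong refl) (auto simp: a_def x_def Out_def sum_distrib_left mult_ac intro!: sum.cong)
      also have "\<dots> = (\<Sum>t\<in>{t\<in>T. src t \<in> - Qn}. x t * trans_vec t v)"
        by (rule sum_Out[OF finT])
      finally have "(\<Sum>t\<in>{t\<in>T. src t \<in> Qn}. l (Inr (Inl t)) * a (Inr (Inl t)) v)
          + (\<Sum>p\<in>-Qn. l (Inr (Inr p)) * a (Inr (Inr p)) v)
          = (\<Sum>t\<in>{t\<in>T. src t \<in> Qn}. x t * trans_vec t v) + (\<Sum>t\<in>{t\<in>T. src t \<in> - Qn}. x t * trans_vec t v)"
        by (simp add: a_def x_def)
      also have "\<dots> = (\<Sum>t\<in>T. x t * trans_vec t v)"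
        using finT by (subst sum.union_disjoint[symmetric]) (auto intro!: sum.cong)
      finally show ?thesis
        using l(2) by (simp add: sumK)
    qed
    \<comment> \<open>In a counter coordinate, the multiplier of the constraint
      \<open>y i \<ge> 0\<close> appears as the surplus of the total effect; the 1 at
      \<open>c\<close> comes from the target \<open>b\<close>.\<close>
    have eff: "(\<Sum>t\<in>T. x t * of_int (upd t i)) = (if i = c then 1 else 0) + l (Inl i)" for i
      using eq[of "Inl i"] by (simp add: b_def a_def trans_vec_def if_distrib[of "(*) _"] cong: if_cong)
    have bal: "outflow T x q = (\<Sum>t\<in>In T q. x t)" for q
    proof -
      have "0 = (\<Sum>t\<in>T. x t * trans_vec t (Inr q))"
        using eq[of "Inr q"] by (simp add: b_def a_def)
      also have "\<dots> = (\<Sum>t\<in>T. if tgt t = q then x t else 0) - (\<Sum>t\<in>T. if src t = q then x t else 0)"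
        unfolding sum_subtractf[symmetric] by (intro sum.cong) (auto simp: trans_vec_def)
      finally show ?thesis
        using finT by (simp add: outflow_def Out_def In_def sum.inter_filter)
    qed
    \<comment> \<open>Outflows are made natural because they will become repetition counts in a
      schedule.\<close>
    from common_denominator[of UNIV "outflow T x"] obtain m where
      m: "m > 0" "\<And>p. of_nat m * outflow T x p \<in> \<int>" by auto
    define X where "X t = real_of_rat (of_nat m * x t)" for t
    have X_sum: "(\<Sum>t\<in>S. X t * of_int (f t)) = of_rat (of_nat m * (\<Sum>t\<in>S. x t * of_int (f t)))" for S f
      by (simp add: X_def of_rat_sum of_rat_mult sum_distrib_left mult_ac)
    have X_out: "outflow T X p = of_rat (of_nat m * outflow T x p)" for p
      using X_sum[of "\<lambda>_. 1" "Out T p"] by (simp add: outflow_def)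
    have "mdp_flow Qn T P X"
      unfolding mdp_flow_def
    proof (intro conjI allI ballI impI)
      show "X t \<ge> 0" if "t \<in> T" for t using x_nn[OF that] by (simp add: X_def)
      show "outflow T X q = (\<Sum>t\<in>In T q. X t)" for q
        using X_sum[of "\<lambda>_. 1" "In T q"] by (simp add: X_out bal)
      fix p t assume pt: "p \<notin> Qn" "t \<in> Out T p"
      have "(\<Sum>t\<in>Out T p. x t) = (\<Sum>t\<in>Out T p. l (Inr (Inr p)) * R t)"
        using pt by (intro sum.cong) (auto simp: x_def Out_def)
      moreover have "(\<Sum>t\<in>Out T p. R t) = 1"
      proof -
        have "real_of_rat (\<Sum>t\<in>Out T p. R t) = (\<Sum>t\<in>Out T p. P t)"
          using R_Out[OF pt(1)] by (simp add: of_rat_sum)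
        also have "\<dots> = 1" using A pt(1) by (auto simp: vass_mdp_def)
        finally show ?thesis by simp
      qed
      ultimately have "outflow T x p = l (Inr (Inr p))"
        by (simp add: outflow_def flip: sum_distrib_left)
      then show "X t = P t * outflow T X p"
        using pt R_Out[OF pt] by (simp add: X_out) (simp add: X_def x_def Out_def of_rat_mult)
    qed
    moreover have "outflow T X p \<in> \<nat>" for p
    proof -
      have "outflow T x p \<ge> 0" unfolding outflow_def by (intro sum_nonneg x_nn) (auto simp: Out_def)
      then show ?thesis
        using m(2)[of p] unfolding X_out Nats_altdef2 by (auto elim!: Ints_cases)
    qed
    moreover have "(\<Sum>t\<in>T. X t * of_int (upd t i)) = of_nat m * of_rat ((if i = c then 1 else 0) + l (Inl i))" for i
      unfolding X_sum eff by (simp add: of_rat_mult)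
    moreover have "l (Inl i) \<ge> 0" for i using l(1) by (auto simp: K_def)
    ultimately show ?thesis
      using m(1) by (intro exI[of _ X]) (auto simp: add_pos_nonneg)
  qed
qed

subsection \<open>Memoryless strategies with constant gain\<close>

text \<open>Probabilistic states also receive a distribution, forced to agree with \<open>P\<close>,
  so that \<open>\<alpha>\<close> alone describes the Markov chain.\<close>

definition memoryless ::
  "'q set \<Rightarrow> ('q, 'd) trans set \<Rightarrow> (('q, 'd) trans \<Rightarrow> real) \<Rightarrow> ('q \<Rightarrow> ('q, 'd) trans pmf) \<Rightarrow> bool" where
  "memoryless Qn T P \<alpha> \<longleftrightarrow>
     (\<forall>p. set_pmf (\<alpha> p) \<subseteq> Out T p) \<and> (\<forall>p t. p \<notin> Qn \<longrightarrow> t \<in> Out T p \<longrightarrow> pmf (\<alpha> p) t = P t)"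

definition chain_edges :: "('q \<Rightarrow> ('q, 'd) trans pmf) \<Rightarrow> ('q \<times> 'q) set" where
  "chain_edges \<alpha> = {(p, tgt t) | p t. t \<in> set_pmf (\<alpha> p)}"

definition chain_mean ::
  "('q, 'd) trans set \<Rightarrow> ('q \<Rightarrow> ('q, 'd) trans pmf) \<Rightarrow> 'q \<Rightarrow> (('q, 'd) trans \<Rightarrow> real) \<Rightarrow> real" where
  "chain_mean T \<alpha> p f = (\<Sum>t\<in>Out T p. pmf (\<alpha> p) t * f t)"

lemma chain_mean_const:
  "finite T \<Longrightarrow> memoryless Qn T P \<alpha> \<Longrightarrow> chain_mean T \<alpha> p (\<lambda>_. a) = a"
  by (simp add: chain_mean_def memoryless_def sum_pmf_eq_1 Out_def flip: sum_distrib_right)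

lemma chain_mean_add:
  "chain_mean T \<alpha> p (\<lambda>t. f t + g t) = chain_mean T \<alpha> p f + chain_mean T \<alpha> p g"
  by (simp add: chain_mean_def sum.distrib distrib_left)

lemma chain_mean_cmult:
  "chain_mean T \<alpha> p (\<lambda>t. a * f t) = a * chain_mean T \<alpha> p f"
  by (simp add: chain_mean_def sum_distrib_left mult_ac)

lemma chain_mean_diff_const:
  assumes "finite T" "memoryless Qn T P \<alpha>"
  shows "chain_mean T \<alpha> p (\<lambda>t. f t - a) = chain_mean T \<alpha> p f - a"
  using chain_mean_add[of T \<alpha> p f "\<lambda>_. - a"] chain_mean_const[OF assms, of p "- a"] by simp

section \<open>The maximum principle and the Poisson equation\<close>

lemma chain_mean_le_imp_eq:
  assumes "finite T" "memoryless Qn T P \<alpha>"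
    and le: "\<And>q. h q \<le> h p" and ge: "chain_mean T \<alpha> p (\<lambda>t. h (tgt t)) \<ge> h p"
    and edge: "(p, q) \<in> chain_edges \<alpha>"
  shows "h q = h p"
proof -
  from edge obtain t where t: "t \<in> set_pmf (\<alpha> p)" "q = tgt t" by (auto simp: chain_edges_def)
  then have tO: "t \<in> Out T p" using assms(2) by (auto simp: memoryless_def)
  have fin: "finite (Out T p)" using assms(1) by (simp add: Out_def)
  \<comment> \<open>A weighted sum of the nonnegative gaps \<open>h p - h (tgt t)\<close> that is at
    most zero: every gap of positive weight vanishes.\<close>
  have "(\<Sum>t\<in>Out T p. pmf (\<alpha> p) t * (h p - h (tgt t))) = h p - chain_mean T \<alpha> p (\<lambda>t. h (tgt t))"
    using chain_mean_const[OF assms(1,2), of p "h p"]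
    by (simp add: chain_mean_def right_diff_distrib sum_subtractf)
  also have "\<dots> \<le> 0" using ge by simp
  finally have "(\<Sum>t\<in>Out T p. pmf (\<alpha> p) t * (h p - h (tgt t))) = 0"
    using le by (intro antisym sum_nonneg mult_nonneg_nonneg) auto
  then have "pmf (\<alpha> p) t * (h p - h (tgt t)) = 0"
    using le fin tO by (subst (asm) sum_nonneg_eq_0_iff) auto
  with t show ?thesis by (simp add: set_pmf_iff)
qed

text \<open>At a maximum of a subharmonic function all successors are maxima too, and following
  edges from there eventually leads to \<open>p0\<close>.\<close>

lemma harmonic_constant:
  assumes "finite T" "memoryless Qn T P \<alpha>"
    and reach: "\<And>p. (p, p0) \<in> (chain_edges \<alpha>)\<^sup>*"
    and harm: "\<And>p. chain_mean T \<alpha> p (\<lambda>t. h (tgt t)) \<ge> h p"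
  shows "h (p::'q::finite) \<le> h p0"
proof -
  define m where "m = Max (range h)"
  have le: "h q \<le> m" for q by (simp add: m_def)
  have "m \<in> range h" unfolding m_def by (rule Max_in) auto
  then obtain q where q: "h q = m" by auto
  have "h p0 = m"
    using reach[of q]
  proof (induction rule: rtrancl_induct)
    case base
    show ?case by (rule q)
  next
    case (step r s)
    with chain_mean_le_imp_eq[OF assms(1,2) _ harm step(2)] le show ?case by simp
  qed
  with le show ?thesis by simp
qed

text \<open>The Poisson equation: the linear map sending \<open>h\<close> to its drift minus the constant \<open>h p0\<close> is
  injective by the maximum principle, hence surjective.\<close>

lemma poisson_equation:
  fixes \<alpha> :: "'q::finite \<Rightarrow> ('q, 'd) trans pmf"
  assumes "finite T" "memoryless Qn T P \<alpha>"
    and reach: "\<And>p. (p, p0) \<in> (chain_edges \<alpha>)\<^sup>*"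
  shows "\<exists>g h. \<forall>p. chain_mean T \<alpha> p (\<lambda>t. r t + h (tgt t) - h p) = g"
proof -
  define L :: "real^'q \<Rightarrow> real^'q" where
    "L h = (\<chi> p. chain_mean T \<alpha> p (\<lambda>t. h $ tgt t) - h $ p - h $ p0)" for h
  have "linear L"
    by (rule linearI)
      (simp_all add: L_def vec_eq_iff chain_mean_add chain_mean_cmult algebra_simps)
  have zero: "h = 0" if "L h = 0" for h
  proof -
    have L: "chain_mean T \<alpha> p (\<lambda>t. h $ tgt t) = h $ p + h $ p0" for p
      using that by (simp add: L_def vec_eq_iff algebra_simps)
    have Lneg: "chain_mean T \<alpha> p (\<lambda>t. - (h $ tgt t)) = - (h $ p) - h $ p0" for p
      using L[of p] chain_mean_cmult[of T \<alpha> p "-1" "\<lambda>t. h $ tgt t"] by simp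
    have "h $ p0 = 0"
    \<comment> \<open>An element of the kernel has the constant drift \<open>h $ p0\<close>. If this
      is positive, \<open>h\<close> is subharmonic and maximal at \<open>p0\<close>, where it cannot
      increase in mean; the negative case is symmetric.\<close>
    proof (rule ccontr)
      assume "h $ p0 \<noteq> 0"
      then consider "h $ p0 > 0" | "h $ p0 < 0" by linarith
      then show False
      proof cases
        case 1
        have *: "h $ q \<le> h $ p0" for q
          by (rule harmonic_constant[OF assms, of "($) h"]) (use 1 L in auto)
        have "chain_mean T \<alpha> p0 (\<lambda>t. h $ tgt t) \<le> chain_mean T \<alpha> p0 (\<lambda>_. h $ p0)"
          unfolding chain_mean_def by (intro sum_mono mult_left_mono *) auto
        with 1 L show False by (simp add: chain_mean_const[OF assms(1,2)])
      next
        case 2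
        have *: "- (h $ q) \<le> - (h $ p0)" for q
          by (rule harmonic_constant[OF assms, of "\<lambda>q. - (h $ q)"]) (use 2 Lneg in auto)
        have "chain_mean T \<alpha> p0 (\<lambda>t. - (h $ tgt t)) \<le> chain_mean T \<alpha> p0 (\<lambda>_. - (h $ p0))"
          unfolding chain_mean_def by (intro sum_mono mult_left_mono *) auto
        with 2 Lneg show False by (simp add: chain_mean_const[OF assms(1,2)])
      qed
    qed
    moreover have "h $ q \<le> h $ p0" for q
      by (rule harmonic_constant[OF assms, of "($) h"]) (use \<open>h $ p0 = 0\<close> L in auto)
    moreover have "- (h $ q) \<le> - (h $ p0)" for q
      by (rule harmonic_constant[OF assms, of "\<lambda>q. - (h $ q)"]) (use \<open>h $ p0 = 0\<close> Lneg in auto)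
    ultimately show "h = 0" by (simp add: vec_eq_iff antisym)
  qed
  then have "surj L"
    using \<open>linear L\<close> by (simp add: linear_injective_imp_surjective linear_injective_0)
  \<comment> \<open>Subtracting \<open>h $ p0\<close> in \<open>L\<close> makes room for the unknown
    gain: the value of the solution at \<open>p0\<close> is the gain itself.\<close>
  then obtain h where h: "L h = (\<chi> p. - chain_mean T \<alpha> p r)" by (metis surjD)
  have "chain_mean T \<alpha> p (\<lambda>t. r t + h $ tgt t - h $ p) = h $ p0" for p
  proof -
    have "chain_mean T \<alpha> p (\<lambda>t. r t + h $ tgt t - h $ p)
        = chain_mean T \<alpha> p r + chain_mean T \<alpha> p (\<lambda>t. h $ tgt t) - h $ p"
      by (simp add: chain_mean_diff_const[OF assms(1,2)] chain_mean_add)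
    moreover have "chain_mean T \<alpha> p (\<lambda>t. h $ tgt t) - h $ p - h $ p0 = - chain_mean T \<alpha> p r"
      using h by (simp add: L_def vec_eq_iff)
    ultimately show ?thesis by simp
  qed
  then show ?thesis by (intro exI[of _ "h $ p0"] exI[of _ "($) h"]) simp
qed

section \<open>Strongly connected components of the support of a flow\<close>

definition flow_edges :: "('q, 'd) trans set \<Rightarrow> (('q, 'd) trans \<Rightarrow> real) \<Rightarrow> ('q \<times> 'q) set" where
  "flow_edges T x = {(src t, tgt t) | t. t \<in> T \<and> x t > 0}"

text \<open>By balance, the flow entering a set of states equals the flow leaving it. Nothing leaves
  a closed set, so no edge of the support enters it either.\<close>

lemma flow_edges_closed:
  fixes T :: "('q::finite, 'd) trans set"
  assumes "finite T" "mdp_flow Qn T P x"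
    and closed: "\<And>p q. p \<in> A \<Longrightarrow> (p, q) \<in> flow_edges T x \<Longrightarrow> q \<in> A"
    and edge: "(p, q) \<in> flow_edges T x" "q \<in> A"
  shows "p \<in> A"
proof (rule ccontr)
  assume "p \<notin> A"
  from edge obtain t where t: "t \<in> T" "src t = p" "tgt t = q" "x t > 0"
    by (auto simp: flow_edges_def)
  have nn: "x t \<ge> 0" if "t \<in> T" for t using assms(2) that by (simp add: mdp_flow_def)
  have zero: "x t = 0" if "t \<in> T" "src t \<in> A" "tgt t \<notin> A" for t
  proof (rule ccontr)
    assume "x t \<noteq> 0"
    with nn[OF that(1)] that(1) have "(src t, tgt t) \<in> flow_edges T x"
      unfolding flow_edges_def by (intro CollectI exI[of _ t]) auto
    with closed that show False by blast
  qed
  have "(\<Sum>t\<in>{t\<in>T. tgt t \<in> A}. x t) = (\<Sum>q\<in>A. outflow T x q)"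
    using assms(2) by (simp add: sum_In[OF assms(1), symmetric] mdp_flow_def)
  also have "\<dots> = (\<Sum>t\<in>{t\<in>T. src t \<in> A}. x t)"
    unfolding outflow_def by (rule sum_Out[OF assms(1)])
  also have "\<dots> = (\<Sum>t\<in>{t\<in>T. src t \<in> A \<and> tgt t \<in> A}. x t)"
    using assms(1) zero by (intro sum.mono_neutral_right) auto
  also have "\<dots> < (\<Sum>t\<in>{t\<in>T. tgt t \<in> A}. x t)"
    using assms(1) t edge(2) \<open>p \<notin> A\<close> nn
    by (intro sum_strict_mono2[of _ _ t]) auto
  finally show False by simp
qed

text \<open>The set reachable from the end of an edge is closed, hence contains the start of the
  edge. Thus every component of the support is strongly connected.\<close>

lemma flow_edges_sym:
  fixes T :: "('q::finite, 'd) trans set"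
  assumes "finite T" "mdp_flow Qn T P x" "(p, q) \<in> (flow_edges T x)\<^sup>*"
  shows "(q, p) \<in> (flow_edges T x)\<^sup>*"
  using assms(3)
proof (induction rule: converse_rtrancl_induct)
  case (step r s)
  have "r \<in> {u. (s, u) \<in> (flow_edges T x)\<^sup>*}"
    by (rule flow_edges_closed[OF assms(1,2) _ step(1)]) auto
  with step show ?case by auto
qed simp

text \<open>Inside the component \<open>R\<close> of \<open>p0\<close> the strategy follows the
  proportions of the flow, which agree with \<open>P\<close> at probabilistic states. Outside
  \<open>R\<close> every transition gets positive probability, so strong connectivity of the graph
  leads to \<open>R\<close>, and within \<open>R\<close> the flow leads to
  \<open>p0\<close>.\<close>

lemma ex_flow_strategy:
  fixes T :: "('q::finite, 'd::finite) trans set"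
  assumes A: "vass_mdp Qn T P" and sc: "strongly_connected T"
    and x: "mdp_flow Qn T P x"
    and p0: "outflow T x p0 > 0"
  defines "R \<equiv> (flow_edges T x)\<^sup>* `` {p0}"
  shows "\<exists>\<alpha>. memoryless Qn T P \<alpha> \<and> (\<forall>p. (p, p0) \<in> (chain_edges \<alpha>)\<^sup>*) \<and>
    (\<forall>p\<in>R. \<forall>t\<in>Out T p. outflow T x p * pmf (\<alpha> p) t = x t)"
proof -
  have finT: "finite T" using A by (simp add: vass_mdp_def)
  have finO: "finite (Out T p)" for p using finT by (simp add: Out_def)
  have x_nn: "x t \<ge> 0" if "t \<in> Out T p" for t p using x that by (simp add: mdp_flow_def Out_def)
  have Rpos: "outflow T x p > 0" if "p \<in> R" for p
  proof -
    from that have "(p0, p) \<in> (flow_edges T x)\<^sup>*" by (simp add: R_def)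
    then show ?thesis
    proof (cases rule: rtranclE)
      case base
      with p0 show ?thesis by simp
    next
      case (step s)
      then obtain t where t: "t \<in> T" "x t > 0" "tgt t = p" by (auto simp: flow_edges_def)
      have "(\<Sum>t\<in>In T p. x t) > 0"
        using t finT x by (intro sum_pos2[of _ t]) (auto simp: In_def mdp_flow_def)
      with x show ?thesis by (simp add: mdp_flow_def)
    qed
  qed
  define Good where "Good p k \<longleftrightarrow> set_pmf k \<subseteq> Out T p \<and>
      (p \<notin> Qn \<longrightarrow> (\<forall>t\<in>Out T p. pmf k t = P t)) \<and>
      (p \<in> R \<longrightarrow> (\<forall>t\<in>Out T p. outflow T x p * pmf k t = x t)) \<and>
      (p \<notin> R \<longrightarrow> set_pmf k = Out T p)" for p k
  have "\<exists>k. Good p k" for p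
  proof -
    consider "p \<in> R" | "p \<notin> R" "p \<notin> Qn" | "p \<notin> R" "p \<in> Qn" by blast
    then show ?thesis
    proof cases
      case 1
      have "\<exists>k. \<forall>t. pmf k t = (if t \<in> Out T p then x t / outflow T x p else 0)"
        using x_nn Rpos[OF 1] finO
        by (intro ex_pmf_finite) (auto simp: outflow_def simp flip: sum_divide_distrib)
      then obtain k where k: "\<And>t. pmf k t = (if t \<in> Out T p then x t / outflow T x p else 0)" by blast
      have "Good p k"
        using Rpos[OF 1] 1 x by (auto simp: Good_def set_pmf_iff k mdp_flow_def split: if_splits)
      then show ?thesis ..
    next
      case 2
      from ex_pmf_transition[OF A 2(2)]
      obtain k where k: "\<And>t. pmf k t = (if t \<in> Out T p then P t else 0)" by blast
      have pos: "P t > 0" if "t \<in> Out T p" for t using A 2 that by (auto simp: vass_mdp_def)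
      have "t \<in> set_pmf k \<longleftrightarrow> t \<in> Out T p" for t
        using pos[of t] by (cases "t \<in> Out T p") (simp_all add: set_pmf_iff k)
      then have "set_pmf k = Out T p" by blast
      then have "Good p k"
        using 2 by (simp add: Good_def k)
      then show ?thesis ..
    next
      case 3
      have "Out T p \<noteq> {}" using A by (simp add: vass_mdp_def)
      then have "Good p (pmf_of_set (Out T p))"
        using 3 finO by (simp add: Good_def)
      then show ?thesis ..
    qed
  qed
  then obtain \<alpha> where \<alpha>: "\<And>p. Good p (\<alpha> p)" by metis
  have edge_R: "(p, q) \<in> chain_edges \<alpha>" if "p \<in> R" "(p, q) \<in> flow_edges T x" for p q
  proof -
    from that obtain t where t: "t \<in> Out T p" "tgt t = q" "x t > 0"
      by (auto simp: flow_edges_def Out_def)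
    then have "outflow T x p * pmf (\<alpha> p) t = x t" using \<alpha>[of p] that by (auto simp: Good_def)
    with t have "t \<in> set_pmf (\<alpha> p)" by (auto simp: set_pmf_iff)
    with t show ?thesis by (auto simp: chain_edges_def)
  qed
  have reach_R: "(p, p0) \<in> (chain_edges \<alpha>)\<^sup>*" if "p \<in> R" for p
  proof -
    have "(p, p0) \<in> (flow_edges T x)\<^sup>*"
      using that flow_edges_sym[OF finT x] by (auto simp: R_def)
    then show ?thesis
      using that
    proof (induction rule: converse_rtrancl_induct)
      case (step r s)
      have "s \<in> R" using step.hyps(1) step.prems by (auto simp: R_def)
      with step edge_R show ?case by (meson converse_rtrancl_into_rtrancl)
    qed simp
  qed
  have "(p, p0) \<in> (chain_edges \<alpha>)\<^sup>*" for p
  proof -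
    from sc have "(p, p0) \<in> {(src t, tgt t) | t. t \<in> T}\<^sup>*" by (simp add: strongly_connected_def)
    then show ?thesis
    proof (induction rule: converse_rtrancl_induct)
      case (step r s)
      show ?case
      proof (cases "r \<in> R")
        case False
        from step(1) obtain t where "t \<in> Out T r" "tgt t = s" by (auto simp: Out_def)
        with False \<alpha>[of r] have "(r, s) \<in> chain_edges \<alpha>" by (auto simp: Good_def chain_edges_def)
        with step show ?thesis by (meson converse_rtrancl_into_rtrancl)
      qed (rule reach_R)
    qed simp
  qed
  then show ?thesis
    using \<alpha> by (intro exI[of _ \<alpha>]) (auto simp: memoryless_def Good_def)
qed

text \<open>The outflows on \<open>R\<close> are an unnormalized stationary distribution. Weighting
  the Poisson equation by them and summing cancels the potential \<open>h\<close>.\<close>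

lemma flow_gain:
  fixes T :: "('q::finite, 'd::finite) trans set" and p0 :: 'q
  assumes finT: "finite T" and x: "mdp_flow Qn T P x"
  defines "R \<equiv> (flow_edges T x)\<^sup>* `` {p0}"
  assumes \<alpha>: "memoryless Qn T P \<alpha>"
    and xprop: "\<And>p t. p \<in> R \<Longrightarrow> t \<in> Out T p \<Longrightarrow> outflow T x p * pmf (\<alpha> p) t = x t"
    and gain: "\<And>p. chain_mean T \<alpha> p (\<lambda>t. r t + h (tgt t) - h p) = g"
  shows "(\<Sum>p\<in>R. outflow T x p) * g = (\<Sum>t\<in>{t\<in>T. src t \<in> R}. x t * r t)"
proof -
  have x_nn: "x t \<ge> 0" if "t \<in> T" for t using x that by (simp add: mdp_flow_def)
  have "outflow T x p * g = (\<Sum>t\<in>Out T p. x t * (r t + h (tgt t) - h (src t)))" if "p \<in> R" for p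
  proof -
    have "outflow T x p * g = (\<Sum>t\<in>Out T p. (outflow T x p * pmf (\<alpha> p) t) * (r t + h (tgt t) - h p))"
      using gain[of p] by (simp add: chain_mean_def sum_distrib_left[symmetric] mult.assoc)
    also have "\<dots> = (\<Sum>t\<in>Out T p. x t * (r t + h (tgt t) - h (src t)))"
      using xprop[OF that] by (intro sum.cong) (auto simp: Out_def)
    finally show ?thesis .
  qed
  then have "(\<Sum>p\<in>R. outflow T x p) * g
      = (\<Sum>p\<in>R. \<Sum>t\<in>Out T p. x t * (r t + h (tgt t) - h (src t)))"
    by (simp add: sum_distrib_right)
  also have "\<dots> = (\<Sum>t\<in>{t\<in>T. src t \<in> R}. x t * (r t + h (tgt t) - h (src t)))"
    by (rule sum_Out[OF finT])
  also have "\<dots> = (\<Sum>t\<in>{t\<in>T. src t \<in> R}. x t * r t) +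
      ((\<Sum>t\<in>{t\<in>T. src t \<in> R}. x t * h (tgt t)) - (\<Sum>t\<in>{t\<in>T. src t \<in> R}. x t * h (src t)))"
    by (simp add: algebra_simps sum.distrib sum_subtractf)
  \<comment> \<open>No transition carrying flow crosses the boundary of \<open>R\<close>, so the sum
    may be indexed by targets instead of sources; balance then matches it with the sum over
    sources.\<close>
  also have "(\<Sum>t\<in>{t\<in>T. src t \<in> R}. x t * h (tgt t)) = (\<Sum>t\<in>{t\<in>T. tgt t \<in> R}. x t * h (tgt t))"
  proof -
    have "src t \<in> R \<longleftrightarrow> tgt t \<in> R" if "t \<in> T" "x t \<noteq> 0" for t
    proof -
      have "(src t, tgt t) \<in> flow_edges T x"
        using that x_nn[OF that(1)] by (auto simp: flow_edges_def less_le)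
      then have "(src t, tgt t) \<in> (flow_edges T x)\<^sup>*" by blast
      with flow_edges_sym[OF finT x this] show ?thesis
        unfolding R_def by (auto intro: rtrancl_trans)
    qed
    then have "(\<Sum>t\<in>T. if src t \<in> R then x t * h (tgt t) else 0) = (\<Sum>t\<in>T. if tgt t \<in> R then x t * h (tgt t) else 0)"
      by (intro sum.cong) auto
    then show ?thesis using finT by (simp add: sum.inter_filter)
  qed
  also have "(\<Sum>t\<in>{t\<in>T. tgt t \<in> R}. x t * h (tgt t)) = (\<Sum>p\<in>R. outflow T x p * h p)"
    using x by (simp add: sum_In[OF finT, symmetric] mdp_flow_def sum_distrib_right)
      (auto simp: In_def intro!: sum.cong)
  also have "(\<Sum>t\<in>{t\<in>T. src t \<in> R}. x t * h (src t)) = (\<Sum>p\<in>R. outflow T x p * h p)"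
    by (simp add: sum_Out[OF finT, symmetric] outflow_def sum_distrib_right)
      (auto simp: Out_def intro!: sum.cong)
  finally show ?thesis by simp
qed

text \<open>All states of a component share one component gain. Counting it once per state, weighted
  by outflow, gives the total weight \<open>S\<close> of the component, which cancels the
  normalization and avoids choosing representatives.\<close>

lemma flow_gain_total:
  fixes T :: "('q::finite, 'd::finite) trans set"
  assumes finT: "finite T" and x: "mdp_flow Qn T P x"
  defines "R \<equiv> \<lambda>p0. (flow_edges T x)\<^sup>* `` {p0}"
  assumes gain: "\<And>p0. outflow T x p0 > 0 \<Longrightarrow>
      (\<Sum>p\<in>R p0. outflow T x p) * g p0 = (\<Sum>t\<in>{t\<in>T. src t \<in> R p0}. x t * r t)"
  shows "(\<Sum>p0\<in>UNIV. outflow T x p0 * g p0) = (\<Sum>t\<in>T. x t * r t)"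
proof -
  have x_nn: "x t \<ge> 0" if "t \<in> T" for t using x that by (simp add: mdp_flow_def)
  have X_nn: "outflow T x p \<ge> 0" for p
    unfolding outflow_def by (intro sum_nonneg x_nn) (auto simp: Out_def)
  define S where "S p0 = (\<Sum>p\<in>R p0. outflow T x p)" for p0
  define e where "e p = (\<Sum>t\<in>Out T p. x t * r t)" for p
  have e0: "e p = 0" if "outflow T x p = 0" for p
  proof -
    have "finite (Out T p)" "\<And>t. t \<in> Out T p \<Longrightarrow> x t \<ge> 0" using finT x_nn by (auto simp: Out_def)
    with that have "\<forall>t\<in>Out T p. x t = 0"
      unfolding outflow_def by (simp add: sum_nonneg_eq_0_iff)
    then show ?thesis by (simp add: e_def)
  qed
  have Rsym: "R p = R q" if "p \<in> R q" for p q
    using that flow_edges_sym[OF finT x] unfolding R_def by (auto intro: rtrancl_trans)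
  have Rrefl: "p \<in> R p" for p by (simp add: R_def)
  have Spos: "S p > 0" if "outflow T x p > 0" for p
    unfolding S_def using that X_nn Rrefl by (intro sum_pos2[of _ p]) auto
  have "outflow T x p0 * g p0 = (\<Sum>p\<in>UNIV. if p \<in> R p0 then outflow T x p0 * e p / S p0 else 0)" for p0
  proof (cases "outflow T x p0 = 0")
    case False
    then have pos: "outflow T x p0 > 0" using X_nn[of p0] by simp
    have "(\<Sum>t\<in>{t\<in>T. src t \<in> R p0}. x t * r t) = (\<Sum>p\<in>R p0. e p)"
      unfolding e_def by (rule sum_Out[OF finT, symmetric])
    with gain[OF pos] Spos[OF pos] have "g p0 = (\<Sum>p\<in>R p0. e p) / S p0"
      by (simp add: S_def field_simps)
    then show ?thesis
      by (simp add: sum.If_cases sum_distrib_left sum_divide_distrib)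
  qed (simp add: if_distrib[of "\<lambda>x. x / _"] cong: if_cong)
  then have "(\<Sum>p0\<in>UNIV. outflow T x p0 * g p0)
      = (\<Sum>p\<in>UNIV. \<Sum>p0\<in>UNIV. if p \<in> R p0 then outflow T x p0 * e p / S p0 else 0)"
    by (simp, subst sum.swap, simp)
  also have "\<dots> = (\<Sum>p\<in>UNIV. e p)"
  proof (rule sum.cong[OF refl])
    fix p
    have "(\<Sum>p0\<in>UNIV. if p \<in> R p0 then outflow T x p0 * e p / S p0 else 0)
        = (\<Sum>p0\<in>UNIV. if p0 \<in> R p then outflow T x p0 * (e p / S p) else 0)"
    proof (rule sum.cong[OF refl])
      fix p0
      have "p \<in> R p0 \<longleftrightarrow> p0 \<in> R p" using Rsym Rrefl by blast
      moreover have "S p0 = S p" if "p0 \<in> R p" using Rsym[OF that] by (simp add: S_def)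
      ultimately show "(if p \<in> R p0 then outflow T x p0 * e p / S p0 else 0)
          = (if p0 \<in> R p then outflow T x p0 * (e p / S p) else 0)" by simp
    qed
    also have "\<dots> = S p * (e p / S p)"
      by (simp add: S_def sum.If_cases sum_distrib_right sum_divide_distrib)
    \<comment> \<open>If the outflow of \<open>p\<close> is zero, the division by \<open>S p\<close>
      may be degenerate, but then \<open>e p\<close> is zero as well.\<close>
    also have "\<dots> = e p"
      using Spos[of p] e0[of p] X_nn[of p] by (cases "outflow T x p = 0") (auto simp: less_le)
    finally show "(\<Sum>p0\<in>UNIV. if p \<in> R p0 then outflow T x p0 * e p / S p0 else 0) = e p" .
  qed
  also have "\<dots> = (\<Sum>t\<in>T. x t * r t)"
    unfolding e_def by (simp add: sum_Out[OF finT])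
  finally show ?thesis .
qed

text \<open>Repeating each state \<open>p\<close> exactly \<open>outflow T x p\<close> times in a list turns the weights of the
  convex combination into time slots of equal length.\<close>

lemma ex_strategy_schedule:
  fixes T :: "('q::finite, 'd::finite) trans set"
  assumes A: "vass_mdp Qn T P" and sc: "strongly_connected T"
    and x: "mdp_flow Qn T P x" and nat: "\<And>p. outflow T x p \<in> \<nat>"
  shows "\<exists>(js :: 'q list) \<alpha> g h. (\<forall>p\<in>set js. memoryless Qn T P (\<alpha> p) \<and>
      (\<forall>i q. chain_mean T (\<alpha> p) q (\<lambda>t. real_of_int (upd t i) + h p i (tgt t) - h p i q) = g p i)) \<and>
    (\<forall>i. (\<Sum>k<length js. g (js ! k) i) = (\<Sum>t\<in>T. x t * upd t i))"
proof -
  have finT: "finite T" using A by (simp add: vass_mdp_def)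
  define Opt where "Opt p \<alpha> g h \<longleftrightarrow> memoryless Qn T P \<alpha> \<and>
      (\<forall>i q. chain_mean T \<alpha> q (\<lambda>t. of_int (upd t i) + h i (tgt t) - h i q) = g i) \<and>
      (\<forall>i. (\<Sum>q\<in>(flow_edges T x)\<^sup>* `` {p}. outflow T x q) * g i =
        (\<Sum>t\<in>{t\<in>T. src t \<in> (flow_edges T x)\<^sup>* `` {p}}. x t * of_int (upd t i)))"
    for p \<alpha> and g :: "'d \<Rightarrow> real" and h
  have "\<exists>\<alpha> g h. Opt p \<alpha> g h" if "outflow T x p > 0" for p
  proof -
    from ex_flow_strategy[OF A sc x that] obtain \<alpha> where \<alpha>:
      "memoryless Qn T P \<alpha>" "\<And>q. (q, p) \<in> (chain_edges \<alpha>)\<^sup>*"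
      "\<And>q t. q \<in> (flow_edges T x)\<^sup>* `` {p} \<Longrightarrow> t \<in> Out T q \<Longrightarrow> outflow T x q * pmf (\<alpha> q) t = x t"
      by blast
    have "\<forall>i. \<exists>g h. \<forall>q. chain_mean T \<alpha> q (\<lambda>t. of_int (upd t i) + h (tgt t) - h q) = g"
      by (intro allI poisson_equation[OF finT \<alpha>(1,2)])
    from choice[OF this] obtain g where
      "\<forall>i. \<exists>h. \<forall>q. chain_mean T \<alpha> q (\<lambda>t. of_int (upd t i) + h (tgt t) - h q) = g i" by blast
    from choice[OF this] obtain h where
      gh: "\<And>i q. chain_mean T \<alpha> q (\<lambda>t. of_int (upd t i) + h i (tgt t) - h i q) = g i" by blast
    have "Opt p \<alpha> g h"
      unfolding Opt_def using \<alpha>(1) gh flow_gain[OF finT x \<alpha>(1,3) gh] by blast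
    then show ?thesis by blast
  qed
  then obtain \<alpha> g h where agh: "\<And>p. outflow T x p > 0 \<Longrightarrow> Opt p (\<alpha> p) (g p) (h p)"
    by metis
  define w where "w p = nat \<lfloor>outflow T x p\<rfloor>" for p
  have w: "real (w p) = outflow T x p" for p
    using nat[of p] by (auto simp: w_def elim: Nats_cases)
  obtain js where js: "mset js = (\<Sum>p\<in>UNIV. replicate_mset (w p) p)"
    using ex_mset by blast
  have pos: "outflow T x p > 0" if "p \<in> set js" for p
  proof -
    have "p \<in># (\<Sum>p\<in>UNIV. replicate_mset (w p) p)" using that js by (metis set_mset_mset)
    then have "w p > 0" by (auto simp: set_mset_sum split: if_splits)
    then show ?thesis by (simp flip: w)
  qed
  have "(\<Sum>k<length js. g (js ! k) i) = (\<Sum>t\<in>T. x t * of_int (upd t i))" for i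
  proof -
    have "(\<Sum>k<length js. g (js ! k) i) = sum_list (map (\<lambda>p. g p i) js)"
      by (simp add: sum_list_sum_nth atLeast0LessThan)
    also have "\<dots> = sum_mset (image_mset (\<lambda>p. g p i) (mset js))"
      by (metis mset_map sum_mset_sum_list)
    also have "\<dots> = (\<Sum>p\<in>UNIV. sum_mset (image_mset (\<lambda>p. g p i) (replicate_mset (w p) p)))"
      using sum_comp_morphism[of "\<lambda>M. sum_mset (image_mset (\<lambda>p. g p i) M)"
        "\<lambda>p. replicate_mset (w p) p" UNIV]
      by (simp add: js comp_def)
    also have "\<dots> = (\<Sum>p\<in>UNIV. outflow T x p * g p i)" by (simp add: w)
    also have "\<dots> = (\<Sum>t\<in>T. x t * of_int (upd t i))"
      by (rule flow_gain_total[OF finT x]) (use agh in \<open>simp add: Opt_def\<close>)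
    finally show ?thesis .
  qed
  moreover have "memoryless Qn T P (\<alpha> p) \<and>
      (\<forall>i q. chain_mean T (\<alpha> p) q (\<lambda>t. real_of_int (upd t i) + h p i (tgt t) - h p i q) = g p i)" if "p \<in> set js" for p
    using agh[OF pos[OF that]] by (simp add: Opt_def)
  ultimately show ?thesis
    by (intro exI[of _ js] exI[of _ \<alpha>] exI[of _ g] exI[of _ h]) blast
qed

subsection \<open>The linear estimates\<close>

text \<open>The horizon tends to infinity along the increasing events \<open>E N\<close>, by
  continuity of the measure from below.\<close>

lemma path_measure_maximal_infinite:
  fixes T :: "('q::finite, 'd::finite) trans set" and \<Phi> :: "('q, 'd) trans list \<Rightarrow> real"
  assumes A: "vass_mdp Qn T P" "is_strategy Qn T \<sigma>" and M: "is_path_measure Qn T P \<sigma> p M"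
    and nn: "\<And>ts. \<Phi> ts \<ge> 0"
    and super: "\<And>ts. step_mean Qn T P \<sigma> (p, ts) (\<lambda>t. \<Phi> (ts @ [t])) \<le> \<Phi> ts"
    and K: "K > 0"
  shows "{\<omega>. \<exists>i. K \<le> \<Phi> (run_prefix \<omega> i)} \<in> sets M"
    and "measure M {\<omega>. \<exists>i. K \<le> \<Phi> (run_prefix \<omega> i)} \<le> \<Phi> [] / K"
proof -
  interpret prob_space M using prob_space_path_measure[OF M] .
  define E where "E N = {\<omega>. \<exists>i\<le>N. K \<le> \<Phi> (run_prefix \<omega> i)}" for N
  have "E N = (\<Union>i\<le>N. {\<omega>. K \<le> \<Phi> (run_prefix \<omega> i)})" for N by (auto simp: E_def)
  moreover have "\<dots> N \<in> sets M" for N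
    by (intro sets.finite_UN measurable_run_prefix_Collect[OF sets_path_measure[OF M]]) auto
  ultimately have sets_E: "E N \<in> sets M" for N by simp
  have eq: "{\<omega>. \<exists>i. K \<le> \<Phi> (run_prefix \<omega> i)} = (\<Union>N. E N)" by (auto simp: E_def)
  show "{\<omega>. \<exists>i. K \<le> \<Phi> (run_prefix \<omega> i)} \<in> sets M"
    unfolding eq using sets_E by auto
  have "incseq E" by (auto simp: incseq_def E_def intro: order_trans)
  with sets_E have "(\<lambda>N. measure M (E N)) \<longlonglongrightarrow> measure M (\<Union>N. E N)"
    by (intro finite_Lim_measure_incseq) auto
  then show "measure M {\<omega>. \<exists>i. K \<le> \<Phi> (run_prefix \<omega> i)} \<le> \<Phi> [] / K"
    unfolding eq
    by (rule LIMSEQ_le_const2)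
      (use path_measure_maximal[OF A M nn super K] in \<open>auto simp: E_def\<close>)
qed

section \<open>Counters and termination as functions of finite paths\<close>

definition counters :: "('d \<Rightarrow> int) \<Rightarrow> ('q, 'd) trans list \<Rightarrow> 'd \<Rightarrow> int" where
  "counters v ts c = v c + (\<Sum>t\<leftarrow>ts. upd t c)"

definition alive :: "('d \<Rightarrow> int) \<Rightarrow> ('q, 'd) trans list \<Rightarrow> bool" where
  "alive v ts \<longleftrightarrow> (\<forall>j\<le>length ts. \<not> terminal (counters v (take j ts)))"

lemma counters_snoc: "counters v (ts @ [t]) c = counters v ts c + upd t c"
  by (simp add: counters_def)

lemma alive_snoc: "alive v (ts @ [t]) \<longleftrightarrow> alive v ts \<and> \<not> terminal (counters v (ts @ [t]))"
  by (auto simp: alive_def le_Suc_eq)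

lemma cval_run_prefix: "cval v \<omega> i = counters v (run_prefix \<omega> i)"
  by (induction i) (auto simp: cval_def counters_def run_prefix_Suc fun_eq_iff)

lemma alive_run_prefix: "alive v (run_prefix \<omega> i) \<longleftrightarrow> (\<forall>j\<le>i. \<not> terminal (cval v \<omega> j))"
  by (auto simp: alive_def cval_run_prefix take_run_prefix)

lemma Cmax_run_prefix:
  "Cmax c v \<omega> = (SUP i\<in>{i. alive v (run_prefix \<omega> i)}. ereal (of_int (counters v (run_prefix \<omega> i) c)))"
  by (simp add: Cmax_def alive_run_prefix cval_run_prefix)

lemma Cmax_upper:
  "alive v (run_prefix \<omega> i) \<Longrightarrow> ereal (of_int (counters v (run_prefix \<omega> i) c)) \<le> Cmax c v \<omega>"
  unfolding Cmax_run_prefix by (rule SUP_upper) simp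

lemma sets_Cmax_ge:
  fixes M :: "(nat \<Rightarrow> ('q::finite, 'd::finite) trans) measure"
  assumes "sets M = sets path_space"
  shows "{\<omega>. r \<le> Cmax c v \<omega>} \<in> sets M"
proof -
  \<comment> \<open>The value minus infinity on terminated prefixes turns the supremum over a
    path-dependent index set into a countable supremum of measurable functions.\<close>
  define F where "F ts = (if alive v ts then ereal (of_int (counters v ts c)) else - \<infinity>)"
    for ts :: "('q, 'd) trans list"
  have "Cmax c v \<omega> = (SUP i. F (run_prefix \<omega> i))" for \<omega> :: "nat \<Rightarrow> ('q, 'd) trans"
  proof (rule antisym)
    show "Cmax c v \<omega> \<le> (SUP i. F (run_prefix \<omega> i))"
      unfolding Cmax_run_prefix
    proof (rule SUP_least)
      fix i assume "i \<in> {i. alive v (run_prefix \<omega> i)}"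
      then show "ereal (of_int (counters v (run_prefix \<omega> i) c)) \<le> (SUP i. F (run_prefix \<omega> i))"
        by (intro SUP_upper2[of i]) (auto simp: F_def)
    qed
    show "(SUP i. F (run_prefix \<omega> i)) \<le> Cmax c v \<omega>"
      by (rule SUP_least) (auto simp: F_def Cmax_upper)
  qed
  moreover have "(\<lambda>\<omega>. SUP i. F (run_prefix \<omega> i)) \<in> borel_measurable path_space"
    using measurable_compose[OF measurable_run_prefix, of F] by (intro borel_measurable_SUP) auto
  then have "{\<omega>\<in>space path_space. r \<le> (SUP i. F (run_prefix \<omega> i))} \<in> sets path_space"
    by measurable
  ultimately show ?thesis by (simp add: assms)
qed

lemma last_state_snoc: "last_state (p, ts @ [t]) = tgt t"
  by (simp add: last_state_def)

text \<open>This is what makes \<open>z + y \<bullet> v\<close> a supermartingale under every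
  strategy: at nondeterministic states each single transition is controlled, at probabilistic ones
  only the mean.\<close>

lemma step_mean_eff:
  fixes T :: "('q::finite, 'd::finite) trans set"
  assumes A: "vass_mdp Qn T P" and sol: "is_solution_II Qn T P y z"
  shows "step_mean Qn T P \<sigma> h (\<lambda>t. eff y z t) \<le> 0"
proof (cases "last_state h \<in> Qn")
  case True
  then have "eff y z t \<le> 0" if "t \<in> Out T (last_state h)" for t
    using sol that by (auto simp: is_solution_II_def Out_def)
  then show ?thesis
    unfolding step_mean_def
    by (intro sum_nonpos mult_nonneg_nonpos next_prob_nonneg[OF A]) auto
next
  case False
  then have "step_mean Qn T P \<sigma> h (\<lambda>t. eff y z t) = prob_eff T P y z (last_state h)"
    by (simp add: step_mean_def next_prob_def prob_eff_def)
  with False sol show ?thesis by (simp add: is_solution_II_def)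
qed

text \<open>As long as no counter is negative, \<open>z + y \<bullet> v\<close> dominates the counter \<open>c\<close>. The added constant
  \<open>K0\<close> keeps it nonnegative at the first terminal configuration, so that it may be
  set to zero from then on.\<close>

lemma Cmax_tail_bound:
  fixes T :: "('q::finite, 'd::finite) trans set"
  assumes A: "vass_mdp Qn T P" "is_strategy Qn T \<sigma>" and M: "is_path_measure Qn T P \<sigma> p M"
    and sol: "is_solution_II Qn T P y z" and yc: "y c > 0" and r: "r > 0"
  defines "K0 \<equiv> \<Sum>t\<in>T. \<bar>eff y z t\<bar>"
  shows "measure M {\<omega>. ereal r \<le> Cmax c (vec_n n) \<omega>} \<le>
    2 * real_of_int (z p + int n * (\<Sum>i\<in>UNIV. y i) + K0) / r"
proof -
  interpret prob_space M using prob_space_path_measure[OF M] .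
  let ?v = "vec_n n :: 'd \<Rightarrow> int"
  have finT: "finite T" using A by (simp add: vass_mdp_def)
  have y: "y i \<ge> 0" and z: "z q \<ge> 0" for i q using sol by (auto simp: is_solution_II_def)
  have "K0 \<ge> 0" unfolding K0_def by (intro sum_nonneg) auto
  define E where "E ts = z (last_state (p, ts)) + (\<Sum>i\<in>UNIV. counters ?v ts i * y i) + K0" for ts
  define \<Phi> :: "('q, 'd) trans list \<Rightarrow> real" where
    "\<Phi> ts = (if alive ?v ts then real_of_int (E ts) else 0)" for ts
  have pos: "counters ?v ts i \<ge> 0" if "alive ?v ts" for ts :: "('q, 'd) trans list" and i
    using that by (auto simp: alive_def terminal_def not_less dest!: spec[of _ "length ts"])
  have Ege: "E ts \<ge> counters ?v ts c * y c + K0" if "alive ?v ts" for ts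
  proof -
    have "counters ?v ts c * y c \<le> (\<Sum>i\<in>UNIV. counters ?v ts i * y i)"
      by (rule member_le_sum) (auto intro!: mult_nonneg_nonneg y pos[OF that])
    then show ?thesis using z[of "last_state (p, ts)"] by (simp add: E_def)
  qed
  have Ege': "E ts \<ge> K0" if "alive ?v ts" for ts
    using Ege[OF that] mult_nonneg_nonneg[OF pos[OF that, of c] y[of c]] by linarith
  have nn: "\<Phi> ts \<ge> 0" for ts
    using order_trans[OF \<open>K0 \<ge> 0\<close> Ege'[of ts]] by (simp add: \<Phi>_def)
  have super: "step_mean Qn T P \<sigma> (p, ts) (\<lambda>t. \<Phi> (ts @ [t])) \<le> \<Phi> ts" for ts
  proof (cases "alive ?v ts")
    case False
    then show ?thesis by (simp add: \<Phi>_def alive_snoc step_mean_def)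
  next
    case True
    have "\<Phi> (ts @ [t]) \<le> \<Phi> ts + real_of_int (eff y z t)" if t: "t \<in> Out T (last_state (p, ts))" for t
    proof (cases "alive ?v (ts @ [t])")
      case True
      have "E (ts @ [t]) = E ts + eff y z t"
        using t by (simp add: E_def eff_def last_state_snoc counters_snoc distrib_right sum.distrib Out_def)
      with True \<open>alive ?v ts\<close> show ?thesis by (simp add: \<Phi>_def)
    next
      case False
      have "\<bar>eff y z t\<bar> \<le> K0"
        unfolding K0_def using t finT by (intro member_le_sum) (auto simp: Out_def)
      with Ege'[OF True] have "E ts + eff y z t \<ge> 0" by linarith
      with False True show ?thesis by (simp add: \<Phi>_def flip: of_int_add)
    qed
    then have "step_mean Qn T P \<sigma> (p, ts) (\<lambda>t. \<Phi> (ts @ [t]))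
        \<le> step_mean Qn T P \<sigma> (p, ts) (\<lambda>t. \<Phi> ts + real_of_int (eff y z t))"
      by (intro step_mean_mono A) auto
    also have "\<dots> \<le> \<Phi> ts"
      using step_mean_eff[OF A(1) sol, of \<sigma> "(p, ts)"]
      by (simp add: step_mean_add step_mean_const[OF A])
    finally show ?thesis .
  qed
  \<comment> \<open>\<open>Cmax\<close> is a supremum that need not be attained; halving the
    threshold guarantees a prefix exceeding it.\<close>
  have "{\<omega>. ereal r \<le> Cmax c ?v \<omega>} \<subseteq> {\<omega>. \<exists>i. r / 2 \<le> \<Phi> (run_prefix \<omega> i)}"
  proof safe
    fix \<omega> :: "nat \<Rightarrow> ('q, 'd) trans" assume "ereal r \<le> Cmax c ?v \<omega>"
    then have "ereal (r / 2) < Cmax c ?v \<omega>"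
      by (rule less_le_trans[rotated]) (use r in simp)
    then obtain i where i: "alive ?v (run_prefix \<omega> i)" "r / 2 < counters ?v (run_prefix \<omega> i) c"
      unfolding Cmax_run_prefix less_SUP_iff by auto
    have "counters ?v (run_prefix \<omega> i) c * 1 \<le> counters ?v (run_prefix \<omega> i) c * y c"
      using pos[OF i(1)] yc by (intro mult_left_mono) auto
    also have "\<dots> \<le> E (run_prefix \<omega> i)" using Ege[OF i(1)] \<open>K0 \<ge> 0\<close> by simp
    finally have "counters ?v (run_prefix \<omega> i) c \<le> E (run_prefix \<omega> i)" by simp
    with i show "\<exists>i. r / 2 \<le> \<Phi> (run_prefix \<omega> i)"
      by (intro exI[of _ i]) (simp add: \<Phi>_def)
  qed
  then have "measure M {\<omega>. ereal r \<le> Cmax c ?v \<omega>} \<le> measure M {\<omega>. \<exists>i. r / 2 \<le> \<Phi> (run_prefix \<omega> i)}"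
    by (intro finite_measure_mono path_measure_maximal_infinite(1)[OF A M nn super half_gt_zero[OF r]])
  also have "\<dots> \<le> \<Phi> [] / (r / 2)"
    by (intro path_measure_maximal_infinite(2)[OF A M nn super half_gt_zero[OF r]])
  also have "\<dots> = 2 * \<Phi> [] / r" by simp
  also have "\<dots> \<le> 2 * real_of_int (z p + int n * (\<Sum>i\<in>UNIV. y i) + K0) / r"
  proof -
    have "E [] = z p + n * (\<Sum>i\<in>UNIV. y i) + K0"
      by (simp add: E_def last_state_def counters_def vec_n_def sum_distrib_left)
    moreover have "alive ?v ([] :: ('q, 'd) trans list)"
      by (simp add: alive_def counters_def vec_n_def terminal_def)
    ultimately have "\<Phi> [] = real_of_int (z p + n * (\<Sum>i\<in>UNIV. y i) + K0)"
      by (simp add: \<Phi>_def)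
    then show ?thesis using r by simp
  qed
  finally show ?thesis .
qed

lemma upper_estimate_linear:
  fixes T :: "('q::finite, 'd::finite) trans set"
  assumes A: "vass_mdp Qn T P" and sol: "is_solution_II Qn T P y z" and yc: "y c > 0"
  shows "upper_estimate Qn T P c (\<lambda>n. n)"
  unfolding upper_estimate_def
proof (intro allI impI)
  fix \<epsilon> :: real and p :: 'q and \<sigma>
  assume \<epsilon>: "\<epsilon> > 0" and \<sigma>: "\<forall>n::nat. is_strategy Qn T (\<sigma> n)"
  define K0 where "K0 = (\<Sum>t\<in>T. \<bar>eff y z t\<bar>)"
  define B where "B = real_of_int (z p + K0)"
  define S where "S = real_of_int (\<Sum>i\<in>UNIV. y i)"
  define \<mu> where "\<mu> n = measure (path_measure Qn T P (\<sigma> n) p)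
            {\<omega>. ereal (real n powr (1 + \<epsilon>)) \<le> Cmax c (vec_n n) \<omega>}" for n
  have le: "\<mu> n \<le> 2 * (B + n * S) / real n powr (1 + \<epsilon>)" if "n > 0" for n
    using Cmax_tail_bound[OF A _ is_path_measure_path_measure[OF A] sol yc,
        where \<sigma> = "\<sigma> n" and r = "real n powr (1 + \<epsilon>)" and n = n and p = p]
      \<sigma> that by (simp add: \<mu>_def B_def S_def K0_def algebra_simps)
  have lim: "(\<lambda>n::nat. 2 * (B + n * S) / real n powr (1 + \<epsilon>)) \<longlonglongrightarrow> 0"
    using \<epsilon> by real_asymp
  have "\<mu> \<longlonglongrightarrow> 0"
    by (rule tendsto_sandwich[OF _ _ tendsto_const lim])
      (use le in \<open>auto simp: \<mu>_def eventually_sequentially intro!: exI[of _ 1]\<close>)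
  then have "(\<lambda>n. ereal (\<mu> n)) \<longlonglongrightarrow> 0" by (simp add: zero_ereal_def)
  then show "limsup (\<lambda>n. ereal (measure (path_measure Qn T P (\<sigma> n) p)
            {\<omega>. ereal (real n powr (1 + \<epsilon>)) \<le> Cmax c (vec_n n) \<omega>})) = 0"
    unfolding \<mu>_def by (intro lim_imp_Limsup) auto
qed

text \<open>The initial configuration is not terminal and already has the value \<open>n\<close>, so
  any strategy will do.\<close>

lemma lower_estimate_linear:
  fixes T :: "('q::finite, 'd::finite) trans set"
  assumes A: "vass_mdp Qn T P"
  shows "lower_estimate Qn T P c (\<lambda>n. n)"
  unfolding lower_estimate_def
proof (intro allI impI)
  fix \<epsilon> :: real assume \<epsilon>: "\<epsilon> > 0"
  fix p :: 'q
  define \<sigma> :: "('q, 'd) hist \<Rightarrow> ('q, 'd) trans pmf" where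
    "\<sigma> h = return_pmf (SOME t. t \<in> Out T (last_state h))" for h
  have "(SOME t. t \<in> Out T p) \<in> Out T p" for p
    using A by (simp add: vass_mdp_def some_in_eq)
  then have \<sigma>: "is_strategy Qn T \<sigma>" by (simp add: is_strategy_def \<sigma>_def)
  let ?M = "path_measure Qn T P \<sigma> p"
  interpret prob_space ?M
    using prob_space_path_measure is_path_measure_path_measure[OF A] .
  have "ereal (real n powr (1 - \<epsilon>)) \<le> Cmax c (vec_n n) \<omega>" if "n \<ge> 1" for n \<omega>
  proof -
    have "real n powr (1 - \<epsilon>) \<le> real n powr 1" using that \<epsilon> by (intro powr_mono) auto
    moreover have "alive (vec_n n) (run_prefix \<omega> 0)"
      by (simp add: alive_def counters_def vec_n_def terminal_def)
    from Cmax_upper[OF this, of c] have "ereal (real n) \<le> Cmax c (vec_n n) \<omega>"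
      by (simp add: counters_def vec_n_def)
    ultimately show ?thesis by (metis ereal_less_eq(3) of_nat_0_le_iff order_trans powr_one)
  qed
  moreover have "measure ?M UNIV = 1"
    using prob_space space_path_measure[OF is_path_measure_path_measure[OF A]] by metis
  ultimately have "measure ?M {\<omega>. ereal (real n powr (1 - \<epsilon>)) \<le> Cmax c (vec_n n) \<omega>} = 1" if "n \<ge> 1" for n
    using that by (metis (no_types, lifting) UNIV_eq_I mem_Collect_eq)
  then have "eventually (\<lambda>n. ereal (measure ?M {\<omega>. ereal (real n powr (1 - \<epsilon>)) \<le> Cmax c (vec_n n) \<omega>}) = 1)
      sequentially"
    unfolding eventually_sequentially by (intro exI[of _ 1]) simp
  then have "(\<lambda>n. ereal (measure ?M {\<omega>. ereal (real n powr (1 - \<epsilon>)) \<le> Cmax c (vec_n n) \<omega>})) \<longlonglongrightarrow> 1"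
    by (rule tendsto_eventually)
  then have "liminf (\<lambda>n. ereal (measure ?M {\<omega>. ereal (real n powr (1 - \<epsilon>)) \<le> Cmax c (vec_n n) \<omega>})) = 1"
    by (intro lim_imp_Liminf) auto
  with \<sigma> show "\<exists>p \<sigma>. (\<forall>n. is_strategy Qn T (\<sigma> n)) \<and>
      liminf (\<lambda>n. ereal (measure (path_measure Qn T P (\<sigma> n) p)
        {\<omega>. ereal (real n powr (1 - \<epsilon>)) \<le> Cmax c (vec_n n) \<omega>})) = 1"
    by (intro exI[of _ p] exI[of _ "\<lambda>_. \<sigma>"]) simp
qed

subsection \<open>The quadratic lower estimate\<close>

text \<open>Within a slot the differences telescope; at each slot boundary the potential is
  exchanged, at a cost of at most \<open>2 * H\<close>. The induction keeps the current potential in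
  the bound, which is only estimated by \<open>H\<close> at the end.\<close>

lemma slot_telescope:
  fixes h :: "nat \<Rightarrow> 'q \<Rightarrow> real"
  assumes H: "\<And>k q. \<bar>h k q\<bar> \<le> H"
  shows "(\<Sum>s<t. h (s div L) (st (Suc s)) - h (s div L) (st s)) \<le> 2 * H * (real (t div L) + 1)"
proof -
  have "(\<Sum>s<t. h (s div L) (st (Suc s)) - h (s div L) (st s)) \<le> h (t div L) (st t) + H + 2 * H * real (t div L)"
  proof (induction t)
    case 0
    show ?case using H[of 0 "st 0"] by simp
  next
    case (Suc t)
    show ?case
    proof (cases "Suc t div L = t div L")
      case False
      then have "Suc t div L = Suc (t div L)" by (simp add: div_Suc split: if_splits)
      with Suc H[of "t div L" "st (Suc t)"] H[of "Suc (t div L)" "st (Suc t)"] show ?thesis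
        by (simp add: algebra_simps)
    qed (use Suc in simp)
  qed
  with H[of "t div L" "st t"] show ?thesis by (simp add: algebra_simps)
qed

text \<open>Complete periods are counted exactly; the last, incomplete one has at most
  \<open>m\<close> terms, each at least \<open>-G\<close>.\<close>

lemma periodic_sum_ge:
  fixes f :: "nat \<Rightarrow> real"
  assumes per: "\<And>s. f (s + m) = f s" and G: "\<And>s. \<bar>f s\<bar> \<le> G" and m: "m > 0"
  shows "real (t div m) * (\<Sum>s<m. f s) - G * m \<le> (\<Sum>s<t. f s)"
proof -
  have per': "f (s + q * m) = f s" for q s
    by (induction q) (use per in \<open>simp_all add: add.assoc[symmetric] add.commute[of m]\<close>)
  have "G \<ge> 0" using G[of 0] by linarith
  have "(\<Sum>s\<in>{q * m..<q * m + m}. f s) = (\<Sum>s<m. f s)" for q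
    using sum.shift_bounds_nat_ivl[of f 0 "q * m" m] by (simp add: per' atLeast0LessThan add.commute)
  then have full: "(\<Sum>s<t div m * m. f s) = real (t div m) * (\<Sum>s<m. f s)"
    using sum.nat_group[of f m "t div m"] by simp
  have "(\<Sum>s\<in>{t div m * m..<t}. f s) \<ge> (\<Sum>s\<in>{t div m * m..<t}. - G)"
    using G by (intro sum_mono) (simp add: abs_le_iff minus_le_iff)
  moreover have "(\<Sum>s\<in>{t div m * m..<t}. - G) \<ge> - (G * m)"
  proof -
    have "t - t div m * m \<le> m" using m by (simp add: minus_div_mult_eq_mod less_imp_le)
    then have "real (t - t div m * m) \<le> real m" by (simp only: of_nat_le_iff)
    then have "real (t - t div m * m) * G \<le> real m * G"
      using \<open>G \<ge> 0\<close> by (rule mult_right_mono)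
    then show ?thesis by (simp add: mult.commute)
  qed
  moreover have "(\<Sum>s<t. f s) = (\<Sum>s<t div m * m. f s) + (\<Sum>s\<in>{t div m * m..<t}. f s)"
    unfolding lessThan_atLeast0 by (rule sum.atLeastLessThan_concat[symmetric]) auto
  ultimately show ?thesis using full by linarith
qed

lemma slot_sum_ge:
  fixes \<gamma> :: "nat \<Rightarrow> real"
  assumes G: "\<And>k. \<bar>\<gamma> k\<bar> \<le> G" and W: "W > 0" and L: "L > 0"
  shows "real (t div (W * L)) * (L * (\<Sum>k<W. \<gamma> k)) - G * (W * L) \<le> (\<Sum>s<t. \<gamma> (s div L mod W))"
proof -
  let ?f = "\<lambda>s. \<gamma> (s div L mod W)"
  have per: "?f (s + W * L) = ?f s" for s
    using L by simp
  have "(\<Sum>s<W * L. ?f s) = (\<Sum>k<W. \<Sum>s\<in>{k * L..<k * L + L}. ?f s)"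
    by (rule sum.nat_group[symmetric])
  also have "\<dots> = (\<Sum>k<W. \<Sum>s\<in>{k * L..<k * L + L}. \<gamma> k)"
  proof (intro sum.cong refl)
    fix k s assume "k \<in> {..<W}" "s \<in> {k * L..<k * L + L}"
    then have "s div L = k" by (intro div_nat_eqI) (auto simp: mult.commute)
    with \<open>k \<in> {..<W}\<close> show "?f s = \<gamma> k" by simp
  qed
  also have "\<dots> = L * (\<Sum>k<W. \<gamma> k)" by (simp add: sum_distrib_left)
  finally show ?thesis
    using periodic_sum_ge[of ?f "W * L" G t, OF per G] W L by simp
qed

text \<open>Only the length of the history decides the slot. Slots are numbered without bound; a
  cyclic schedule is expressed by a periodic \<open>\<alpha>\<close>.\<close>

definition slot_strategy ::
  "(nat \<Rightarrow> 'q \<Rightarrow> ('q, 'd) trans pmf) \<Rightarrow> nat \<Rightarrow> ('q, 'd) hist \<Rightarrow> ('q, 'd) trans pmf" where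
  "slot_strategy \<alpha> L hs = \<alpha> (length (snd hs) div L) (last_state hs)"

lemma is_strategy_slot_strategy:
  "(\<And>k. memoryless Qn T P (\<alpha> k)) \<Longrightarrow> is_strategy Qn T (slot_strategy \<alpha> L)"
  by (auto simp: is_strategy_def slot_strategy_def memoryless_def)

lemma step_mean_slot_strategy:
  assumes "\<And>k. memoryless Qn T P (\<alpha> k)"
  shows "step_mean Qn T P (slot_strategy \<alpha> L) hs f = chain_mean T (\<alpha> (length (snd hs) div L)) (last_state hs) f"
  using assms unfolding step_mean_def chain_mean_def
  by (intro sum.cong) (auto simp: next_prob_def slot_strategy_def memoryless_def)

text \<open>Correcting each update by the Poisson solution \<open>h\<close> of its slot makes the sum of the centred
  updates a martingale with bounded increments; \<open>h\<close> itself telescopes within each slot.\<close>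

lemma slot_strategy_counters:
  fixes T :: "('q::finite, 'd::finite) trans set" and h :: "nat \<Rightarrow> 'd \<Rightarrow> 'q \<Rightarrow> real"
    and H D a :: real and N :: nat
  assumes A: "vass_mdp Qn T P" and mem: "\<And>k. memoryless Qn T P (\<alpha> k)"
    and gain: "\<And>k i q. chain_mean T (\<alpha> k) q (\<lambda>t. real_of_int (upd t i) + h k i (tgt t) - h k i q) = g k i"
    and H: "\<And>k i q. \<bar>h k i q\<bar> \<le> H"
    and D: "\<And>k i q t. t \<in> T \<Longrightarrow> \<bar>real_of_int (upd t i) + h k i (tgt t) - h k i q - g k i\<bar> \<le> D"
    and a: "a > 0"
    and M: "is_path_measure Qn T P (slot_strategy \<alpha> L) p M"
  shows "1 - CARD('d) * D\<^sup>2 * N / a\<^sup>2 \<le> measure M {\<omega>. \<forall>j\<le>N. \<forall>i.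
    real_of_int (v i) - a - 2 * H * (real (j div L) + 1) + (\<Sum>s<j. g (s div L) i) \<le> counters v (run_prefix \<omega> j) i}"
proof -
  interpret prob_space M using prob_space_path_measure[OF M] .
  have finT: "finite T" using A by (simp add: vass_mdp_def)
  note \<sigma> = is_strategy_slot_strategy[OF mem, where L = L]
  define \<xi> where "\<xi> k q t i = real_of_int (upd t i) + h k i (tgt t) - h k i q - g k i" for k q t i
  define m where "m ts i = (\<Sum>s<length ts. \<xi> (s div L) (last_state (p, take s ts)) (ts ! s) i)" for ts i
  define C where "C = CARD('d) * D\<^sup>2"
  \<comment> \<open>Each step increases the expected squared norm of \<open>m\<close> by at most
    \<open>C\<close>. The second summand is the budget for the remaining steps, so
    \<open>\<Phi>\<close> is a supermartingale up to the horizon, with initial value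
    \<open>C * N\<close>.\<close>
  define \<Phi> where "\<Phi> ts = (\<Sum>i\<in>UNIV. (m ts i)\<^sup>2) + C * real (N - length ts)" for ts
  have "C \<ge> 0" by (simp add: C_def)
  have m_snoc: "m (ts @ [t]) i = m ts i + \<xi> (length ts div L) (last_state (p, ts)) t i" for ts t i
    by (simp add: m_def nth_append)
  have nn: "\<Phi> ts \<ge> 0" for ts
    unfolding \<Phi>_def using \<open>C \<ge> 0\<close> by (intro add_nonneg_nonneg sum_nonneg) auto
  have super: "step_mean Qn T P (slot_strategy \<alpha> L) (p, ts) (\<lambda>t. \<Phi> (ts @ [t])) \<le> \<Phi> ts"
    if len: "length ts < N" for ts
  proof -
    let ?k = "length ts div L" and ?q = "last_state (p, ts)"
    let ?E = "step_mean Qn T P (slot_strategy \<alpha> L) (p, ts)"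
    have sm: "?E f = chain_mean T (\<alpha> ?k) ?q f" for f
      using step_mean_slot_strategy[OF mem, where hs = "(p, ts)"] by simp
    have E0: "?E (\<lambda>t. \<xi> ?k ?q t i) = 0" for i
      using chain_mean_diff_const[OF finT mem, where f = "\<lambda>t. real_of_int (upd t i) + h ?k i (tgt t) - h ?k i ?q"]
      unfolding sm \<xi>_def by (simp only: gain)
    have E2: "?E (\<lambda>t. (m (ts @ [t]) i)\<^sup>2) \<le> (m ts i)\<^sup>2 + D\<^sup>2" for i
    proof -
      \<comment> \<open>The cross term of the square is kept, as its mean vanishes by
        \<open>E0\<close>.\<close>
      have "(m (ts @ [t]) i)\<^sup>2 \<le> ((m ts i)\<^sup>2 + D\<^sup>2) + 2 * m ts i * \<xi> ?k ?q t i" if "t \<in> Out T ?q" for t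
      proof -
        have "\<bar>\<xi> ?k ?q t i\<bar> \<le> D" using that D unfolding \<xi>_def by (auto simp: Out_def)
        then have "(\<xi> ?k ?q t i)\<^sup>2 \<le> D\<^sup>2" using power_mono[of "\<bar>\<xi> ?k ?q t i\<bar>" D 2] by simp
        then show ?thesis by (simp add: m_snoc power2_sum)
      qed
      then have "?E (\<lambda>t. (m (ts @ [t]) i)\<^sup>2) \<le> ?E (\<lambda>t. ((m ts i)\<^sup>2 + D\<^sup>2) + 2 * m ts i * \<xi> ?k ?q t i)"
        by (intro step_mean_mono A) auto
      also have "\<dots> = (m ts i)\<^sup>2 + D\<^sup>2"
        by (subst step_mean_add) (simp only: step_mean_cmult step_mean_const[OF A \<sigma>] E0 mult_zero_right add_0_right)
      finally show ?thesis .
    qed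
    have "?E (\<lambda>t. \<Phi> (ts @ [t])) = (\<Sum>i\<in>UNIV. ?E (\<lambda>t. (m (ts @ [t]) i)\<^sup>2)) + C * real (N - Suc (length ts))"
      unfolding \<Phi>_def by (simp add: step_mean_add step_mean_sum step_mean_const[OF A \<sigma>])
    also have "\<dots> \<le> (\<Sum>i\<in>UNIV. (m ts i)\<^sup>2 + D\<^sup>2) + C * real (N - Suc (length ts))"
      by (intro add_mono sum_mono E2) auto
    also have "\<dots> = \<Phi> ts"
      using len by (simp add: \<Phi>_def C_def sum.distrib of_nat_diff algebra_simps)
    finally show ?thesis .
  qed
  let ?bad = "{\<omega>. \<exists>j\<le>N. a\<^sup>2 \<le> \<Phi> (run_prefix \<omega> j)}"
  let ?ok = "\<lambda>j ts. \<forall>i. real_of_int (v i) - a - 2 * H * (real (j div L) + 1) + (\<Sum>s<j. g (s div L) i) \<le> counters v ts i"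
  have sets: "{\<omega>. \<forall>j\<le>N. Q j (run_prefix \<omega> j)} \<in> sets M" for Q
  proof -
    have "{\<omega>. \<forall>j\<le>N. Q j (run_prefix \<omega> j)} = {\<omega>. \<forall>j\<le>N. Q j (take j (run_prefix \<omega> N))}"
      by (simp add: take_run_prefix cong: conj_cong imp_cong)
    also have "\<dots> \<in> sets M"
      by (rule measurable_run_prefix_Collect[OF sets_path_measure[OF M]])
    finally show ?thesis .
  qed
  have bad: "measure M ?bad \<le> C * N / a\<^sup>2"
    using path_measure_maximal[OF A \<sigma> M nn super, where K = "a\<^sup>2"] a by (simp add: \<Phi>_def m_def)
  have "- ?bad = {\<omega>. \<forall>j\<le>N. \<not> a\<^sup>2 \<le> \<Phi> (run_prefix \<omega> j)}" by auto
  then have sets_nbad: "- ?bad \<in> sets M" using sets[of "\<lambda>_ ts. \<not> a\<^sup>2 \<le> \<Phi> ts"] by simp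
  \<comment> \<open>Off the bad event every martingale coordinate stays above \<open>-a\<close>;
    solving its definition for the counter gives the bound.\<close>
  have "- ?bad \<subseteq> {\<omega>. \<forall>j\<le>N. ?ok j (run_prefix \<omega> j)}"
  proof (intro subsetI CollectI allI impI)
    fix \<omega> j i assume "\<omega> \<in> - ?bad" and j: "j \<le> N"
    let ?ts = "run_prefix \<omega> j" and ?st = "\<lambda>s. last_state (p, run_prefix \<omega> s)"
    have "(m ?ts i)\<^sup>2 \<le> (\<Sum>i\<in>UNIV. (m ?ts i)\<^sup>2)" by (rule member_le_sum) auto
    also have "\<dots> \<le> \<Phi> ?ts" using \<open>C \<ge> 0\<close> by (simp add: \<Phi>_def)
    also have "\<dots> < a\<^sup>2" using \<open>\<omega> \<in> - ?bad\<close> j by auto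
    finally have "- a \<le> m ?ts i" using a abs_le_square_iff[of "m ?ts i" a] by simp
    also have "m ?ts i = (\<Sum>s<j. \<xi> (s div L) (?st s) (\<omega> s) i)"
      by (simp add: m_def take_run_prefix)
    also have "\<dots> = (\<Sum>s<j. upd (\<omega> s) i) + (\<Sum>s<j. h (s div L) i (?st (Suc s)) - h (s div L) i (?st s))
        - (\<Sum>s<j. g (s div L) i)"
      by (simp add: \<xi>_def run_prefix_Suc last_state_snoc sum.distrib sum_subtractf)
    finally have "- a \<le> \<dots>" .
    moreover have "(\<Sum>s<j. h (s div L) i (?st (Suc s)) - h (s div L) i (?st s)) \<le> 2 * H * (real (j div L) + 1)"
      using slot_telescope[of "\<lambda>k. h k i" H L ?st j] H by simp
    moreover have "counters v ?ts i = v i + (\<Sum>s<j. upd (\<omega> s) i)"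
      by (simp add: cval_run_prefix[symmetric] cval_def)
    ultimately show "real_of_int (v i) - a - 2 * H * (real (j div L) + 1) + (\<Sum>s<j. g (s div L) i) \<le> counters v ?ts i"
      by simp
  qed
  then have "measure M (- ?bad) \<le> measure M {\<omega>. \<forall>j\<le>N. ?ok j (run_prefix \<omega> j)}"
    by (intro finite_measure_mono sets)
  moreover have "measure M (- ?bad) = 1 - measure M ?bad"
    using prob_compl[of "- ?bad"] sets_nbad by (simp add: space_path_measure[OF M] Compl_eq_Diff_UNIV[symmetric])
  ultimately show ?thesis using bad by (simp add: C_def)
qed

lemma ex_abs_bound: "finite A \<Longrightarrow> \<exists>B. \<forall>x\<in>A. \<bar>f x :: real\<bar> \<le> B"
  by (rule exI[of _ "\<Sum>x\<in>A. \<bar>f x\<bar>"]) (auto intro!: member_le_sum)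

lemma lower_estimate_quadratic:
  fixes T :: "('q::finite, 'd::finite) trans set" and js :: "'q list"
    and h :: "'q \<Rightarrow> 'd \<Rightarrow> 'q \<Rightarrow> real"
  assumes A: "vass_mdp Qn T P"
    and mem: "\<And>p. p \<in> set js \<Longrightarrow> memoryless Qn T P (\<alpha> p)"
    and gain: "\<And>p i q. p \<in> set js \<Longrightarrow>
      chain_mean T (\<alpha> p) q (\<lambda>t. real_of_int (upd t i) + h p i (tgt t) - h p i q) = g p i"
    and nonneg: "\<And>i. (\<Sum>k<length js. g (js ! k) i) \<ge> 0"
    and pos: "(\<Sum>k<length js. g (js ! k) c) > 0"
  shows "lower_estimate Qn T P c (\<lambda>n. n ^ 2)"
  unfolding lower_estimate_def
proof (intro allI impI)
  fix \<epsilon> :: real and p :: 'q assume \<epsilon>: "\<epsilon> > 0"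
  \<comment> \<open>The cap keeps the exponents below in range for large \<open>\<epsilon>\<close>;
    a smaller exponent loss only strengthens the bound to be shown.\<close>
  define e where "e = min \<epsilon> (1/2)"
  have e: "0 < e" "e \<le> 1/2" "e \<le> \<epsilon>" using \<epsilon> by (auto simp: e_def)
  define W where "W = length js"
  define S where "S = (\<Sum>k<W. g (js ! k) c)"
  have W: "W > 0" using pos by (auto simp: W_def intro!: Nat.gr0I)
  have S: "S > 0" using pos by (simp add: S_def W_def)
  define J where "J k = js ! (k mod W)" for k
  have J: "J k \<in> set js" for k using W by (simp add: J_def W_def)
  have finT: "finite T" using A by (simp add: vass_mdp_def)
  obtain H where H': "\<forall>x\<in>set js \<times> UNIV \<times> UNIV. \<bar>h (fst x) (fst (snd x)) (snd (snd x))\<bar> \<le> H"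
    using ex_abs_bound[of "set js \<times> (UNIV :: 'd set) \<times> (UNIV :: 'q set)"
      "\<lambda>x. h (fst x) (fst (snd x)) (snd (snd x))"] by auto
  have H: "\<bar>h (J k) i q\<bar> \<le> H" for k i q using bspec[OF H', of "(J k, i, q)"] J by simp
  obtain G where G': "\<forall>x\<in>set js \<times> UNIV. \<bar>g (fst x) (snd x)\<bar> \<le> G"
    using ex_abs_bound[of "set js \<times> (UNIV :: 'd set)" "\<lambda>x. g (fst x) (snd x)"] by auto
  have G: "\<bar>g (J k) i\<bar> \<le> G" for k i using bspec[OF G', of "(J k, i)"] J by simp
  obtain U where U': "\<forall>x\<in>T \<times> UNIV. \<bar>real_of_int (upd (fst x) (snd x))\<bar> \<le> U"
    using ex_abs_bound[of "T \<times> (UNIV :: 'd set)" "\<lambda>x. real_of_int (upd (fst x) (snd x))"] finT by auto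
  have U: "\<bar>real_of_int (upd t i)\<bar> \<le> U" if "t \<in> T" for t i using bspec[OF U', of "(t, i)"] that by simp
  define D where "D = U + 2 * H + G"
  have D: "\<bar>real_of_int (upd t i) + h (J k) i (tgt t) - h (J k) i q - g (J k) i\<bar> \<le> D"
    if "t \<in> T" for t i k q
    using U[OF that, of i] H[of k i q] H[of k i "tgt t"] G[of k i] unfolding D_def by linarith
  have "H \<ge> 0" "G \<ge> 0" using H[of 0 undefined undefined] G[of 0 undefined] by linarith+
  \<comment> \<open>Slots of length about \<open>X\<close> over \<open>X\<close> squared steps:
    there are about \<open>X\<close> slot boundaries, and the martingale also deviates by the order
    of \<open>X\<close>. Both are of smaller order than \<open>n\<close>, while the gain in
    \<open>c\<close> is of order \<open>n powr (2 - e)\<close>.\<close>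
  define X where "X n = real n powr (1 - e / 2)" for n :: nat
  define L where "L n = nat \<lceil>X n\<rceil>" for n
  define N where "N n = nat \<lceil>(X n)\<^sup>2\<rceil>" for n
  have L: "X n \<le> L n" "L n \<le> X n + 1" for n by (auto simp: L_def X_def)
  have N: "(X n)\<^sup>2 \<le> N n" "N n \<le> (X n)\<^sup>2 + 1" for n unfolding N_def by (simp_all add: of_nat_ceiling)
  define \<sigma> where "\<sigma> n = slot_strategy (\<lambda>k. \<alpha> (J k)) (L n)" for n
  define \<mu> where "\<mu> n = measure (path_measure Qn T P (\<sigma> n) p)
      {\<omega>. ereal (real (n\<^sup>2) powr (1 - \<epsilon>)) \<le> Cmax c (vec_n n) \<omega>}" for n
  \<comment> \<open>Adding 1 keeps the constant positive even when \<open>D\<close> is zero.\<close>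
  define K where "K = CARD('d) * D\<^sup>2 + 1"
  have "K > 0" unfolding K_def by (intro add_nonneg_pos) auto
  \<comment> \<open>A quarter of the initial value \<open>n\<close> is reserved for the martingale;
    the other three quarters pay for the slot boundaries and one incomplete round of the
    schedule.\<close>
  have ev1: "eventually (\<lambda>n::nat. 2 * H * (X n + 2) + G * (W * (X n + 1)) \<le> 3 / 4 * real n) sequentially"
  proof -
    define B where "B = 2 * H + G * W + 1"
    have B: "B > 0" using \<open>H \<ge> 0\<close> \<open>G \<ge> 0\<close> unfolding B_def by (simp add: add_nonneg_pos)
    have le: "2 * H * (X n + 2) + G * (W * (X n + 1)) \<le> B * (X n + 2)" for n
      using \<open>H \<ge> 0\<close> \<open>G \<ge> 0\<close> by (simp add: B_def X_def algebra_simps)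
    have "eventually (\<lambda>n. B * (X n + 2) \<le> 3 / 4 * real n) sequentially"
      unfolding X_def using e(1,2) B by real_asymp
    then show ?thesis by (rule eventually_mono) (rule order_trans[OF le])
  qed
  have "eventually (\<lambda>n::nat. ((real n)\<^sup>2) powr (1 - e) \<le> (X n)\<^sup>2 * (S / W) - (X n + 1) * S) sequentially"
    unfolding X_def using e(1,2) S W by real_asymp
  then have ev: "eventually (\<lambda>n::nat. ((real n)\<^sup>2) powr (1 - e) \<le> (X n)\<^sup>2 * (S / W) - (X n + 1) * S \<and> n \<ge> 1) sequentially"
    by (rule eventually_conj[OF _ eventually_ge_at_top])
  have pw: "real (n\<^sup>2) powr (1 - \<epsilon>) \<le> ((real n)\<^sup>2) powr (1 - e)" if "n \<ge> 1" for n
    using that e(3) by (auto intro!: powr_mono)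
  have ev2: "eventually (\<lambda>n::nat. real (n\<^sup>2) powr (1 - \<epsilon>) \<le> (X n)\<^sup>2 * (S / W) - (X n + 1) * S) sequentially"
    using ev by (rule eventually_mono) (blast intro: order_trans[OF pw])
  have "eventually (\<lambda>n. 1 - 16 * K * ((X n)\<^sup>2 + 1) / (real n)\<^sup>2 \<le> \<mu> n) sequentially"
    using eventually_ge_at_top[of 1] ev1 ev2
  proof eventually_elim
    fix n :: nat assume n: "1 \<le> n"
      and ev1: "2 * H * (X n + 2) + G * (W * (X n + 1)) \<le> 3 / 4 * real n"
      and ev2: "real (n\<^sup>2) powr (1 - \<epsilon>) \<le> (X n)\<^sup>2 * (S / W) - (X n + 1) * S"
    have X1: "X n \<ge> 1" using n e by (simp add: X_def ge_one_powr_ge_zero)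
    with L[of n] have L0: "L n > 0" by linarith
    note M = is_path_measure_path_measure[OF A, of "\<sigma> n" p]
    interpret prob_space "path_measure Qn T P (\<sigma> n) p" using prob_space_path_measure[OF M] .
    define low where "low j i = real n - real n / 4 - 2 * H * (real (j div L n) + 1) + (\<Sum>s<j. g (J (s div L n)) i)" for j i
    have sum_ge: "real (j div (W * L n)) * (L n * (\<Sum>k<W. g (js ! k) i)) - G * (W * L n) \<le> (\<Sum>s<j. g (J (s div L n)) i)" for j i
    proof -
      have "\<bar>g (js ! k) i\<bar> \<le> G" if "k < W" for k using G[of k i] that by (simp add: J_def)
      \<comment> \<open>The gains are extended by zero beyond \<open>W\<close>, because
        \<open>slot_sum_ge\<close> asks for a bound at every index.\<close>
      then have "real (j div (W * L n)) * (L n * (\<Sum>k<W. if k < W then g (js ! k) i else 0)) - G * (W * L n)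
          \<le> (\<Sum>s<j. if s div L n mod W < W then g (js ! (s div L n mod W)) i else 0)"
        using slot_sum_ge[of "\<lambda>k. if k < W then g (js ! k) i else 0" G W "L n" j] W L0 \<open>G \<ge> 0\<close> by auto
      moreover have "(\<Sum>k<W. if k < W then g (js ! k) i else 0) = (\<Sum>k<W. g (js ! k) i)"
        by (intro sum.cong) auto
      ultimately show ?thesis using W by (simp add: J_def)
    qed
    have base: "real n - real n / 4 - 2 * H * (real (j div L n) + 1) - G * (W * L n) \<ge> 0" if "j \<le> N n" for j
    proof -
      have "real (j div L n) \<le> real j / real (L n)" by (rule of_nat_div_le_of_nat)
      also have "\<dots> \<le> ((X n)\<^sup>2 + 1) / X n"
        using that N(2)[of n] X1 L(1)[of n] by (intro frac_le) auto
      also have "\<dots> \<le> X n + 1" using X1 by (simp add: field_simps power2_eq_square)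
      finally have "2 * H * (real (j div L n) + 1) \<le> 2 * H * (X n + 2)"
        using \<open>H \<ge> 0\<close> by (intro mult_left_mono) auto
      moreover have "G * (W * L n) \<le> G * (W * (X n + 1))"
        using \<open>G \<ge> 0\<close> L(2)[of n] by (simp add: mult_left_mono)
      ultimately show ?thesis using ev1 by simp
    qed
    have low_nn: "low j i \<ge> 0" if "j \<le> N n" for j i
    proof -
      have "real (j div (W * L n)) * (L n * (\<Sum>k<W. g (js ! k) i)) \<ge> 0"
        using nonneg[of i] by (simp add: W_def)
      with sum_ge[of j i] base[OF that] show ?thesis unfolding low_def by linarith
    qed
    \<comment> \<open>By time \<open>N n\<close> at least \<open>N n / (W * L n) - 1\<close> rounds
      are complete, and each adds \<open>L n * S\<close> to \<open>c\<close>.\<close>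
    have low_c: "real (n\<^sup>2) powr (1 - \<epsilon>) \<le> low (N n) c"
    proof -
      have "(X n)\<^sup>2 * (S / W) - (X n + 1) * S \<le> N n * (S / W) - L n * S"
        using N(1)[of n] L(2)[of n] S by (intro diff_mono mult_right_mono) auto
      also have "\<dots> = (real (N n) / real (W * L n) - 1) * (L n * S)"
        using W L0 by (simp add: field_simps)
      also have "\<dots> \<le> real (N n div (W * L n)) * (L n * S)"
      proof -
        have "N n mod (W * L n) \<le> W * L n" using W L0 by (simp add: less_imp_le)
        then have "real (N n mod (W * L n)) / real (W * L n) \<le> 1"
          unfolding of_nat_le_iff[where 'a = real, symmetric] using W L0 by simp
        then have "real (N n) / real (W * L n) - 1 \<le> real (N n div (W * L n))"
          using of_nat_of_nat_div_aux[of "N n" "W * L n", where 'a = real] by linarith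
        then show ?thesis using S by (intro mult_right_mono) auto
      qed
      also have "\<dots> \<le> low (N n) c"
        using sum_ge[of "N n" c] base[of "N n"] unfolding low_def S_def by linarith
      finally show ?thesis using ev2 by linarith
    qed
    have "1 - CARD('d) * D\<^sup>2 * N n / (real n / 4)\<^sup>2 \<le> measure (path_measure Qn T P (\<sigma> n) p)
        {\<omega>. \<forall>j\<le>N n. \<forall>i. low j i \<le> counters (vec_n n) (run_prefix \<omega> j) i}"
      using slot_strategy_counters[OF A mem[OF J] gain[OF J] H D _ M[unfolded \<sigma>_def], of "real n / 4" "N n" "vec_n n"] n
      by (simp add: low_def \<sigma>_def vec_n_def)
    also have "\<dots> \<le> \<mu> n"
      unfolding \<mu>_def
    proof (intro finite_measure_mono sets_Cmax_ge[OF sets_path_measure[OF M]] subsetI CollectI)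
      fix \<omega> :: "nat \<Rightarrow> ('q, 'd) trans"
      assume \<omega>: "\<omega> \<in> {\<omega>. \<forall>j\<le>N n. \<forall>i. low j i \<le> counters (vec_n n) (run_prefix \<omega> j) i}"
      have "counters (vec_n n) (run_prefix \<omega> j) i \<ge> 0" if "j \<le> N n" for j i
        using \<omega> low_nn[OF that, of i] that by (fastforce dest: order_trans)
      then have "alive (vec_n n) (run_prefix \<omega> (N n))"
        by (auto simp: alive_def terminal_def take_run_prefix not_less)
      note Cmax_upper[OF this, of c]
      moreover have "low (N n) c \<le> counters (vec_n n) (run_prefix \<omega> (N n)) c" using \<omega> by blast
      with low_c have "real (n\<^sup>2) powr (1 - \<epsilon>) \<le> counters (vec_n n) (run_prefix \<omega> (N n)) c" by linarith
      ultimately show "ereal (real (n\<^sup>2) powr (1 - \<epsilon>)) \<le> Cmax c (vec_n n) \<omega>"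
        by (meson ereal_less_eq(3) order_trans)
    qed
    finally have "1 - CARD('d) * D\<^sup>2 * N n / (real n / 4)\<^sup>2 \<le> \<mu> n" .
    moreover have "CARD('d) * D\<^sup>2 * N n / (real n / 4)\<^sup>2 \<le> K * N n / (real n / 4)\<^sup>2"
      by (intro divide_right_mono mult_right_mono) (auto simp: K_def)
    moreover have "K * N n / (real n / 4)\<^sup>2 \<le> 16 * K * ((X n)\<^sup>2 + 1) / (real n)\<^sup>2"
    proof -
      have "K * N n * 16 / (real n)\<^sup>2 \<le> K * ((X n)\<^sup>2 + 1) * 16 / (real n)\<^sup>2"
        using N(2)[of n] \<open>K > 0\<close> by (intro divide_right_mono mult_right_mono mult_left_mono) auto
      then show ?thesis by (simp add: power_divide mult_ac)
    qed
    ultimately show "1 - 16 * K * ((X n)\<^sup>2 + 1) / (real n)\<^sup>2 \<le> \<mu> n" by linarith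
  qed
  \<comment> \<open>The error probability is of order \<open>n powr (- e)\<close>.\<close>
  moreover have "(\<lambda>n::nat. 1 - 16 * K * ((X n)\<^sup>2 + 1) / (real n)\<^sup>2) \<longlonglongrightarrow> 1"
    unfolding X_def using e(1,2) \<open>K > 0\<close> by real_asymp
  moreover have "eventually (\<lambda>n. \<mu> n \<le> 1) sequentially"
    unfolding \<mu>_def
    using prob_space.prob_le_1[OF prob_space_path_measure[OF is_path_measure_path_measure[OF A]]] by simp
  ultimately have "\<mu> \<longlonglongrightarrow> 1"
    by (intro tendsto_sandwich[of _ \<mu> sequentially "\<lambda>_. 1"]) auto
  then have "(\<lambda>n. ereal (\<mu> n)) \<longlonglongrightarrow> 1" by (simp add: one_ereal_def)
  then have "liminf (\<lambda>n. ereal (\<mu> n)) = 1" by (intro lim_imp_Liminf) auto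
  moreover have "is_strategy Qn T (\<sigma> n)" for n
    unfolding \<sigma>_def by (rule is_strategy_slot_strategy[OF mem[OF J]])
  ultimately show "\<exists>p \<sigma>. (\<forall>n. is_strategy Qn T (\<sigma> n)) \<and>
      liminf (\<lambda>n. ereal (measure (path_measure Qn T P (\<sigma> n) p)
        {\<omega>. ereal (real (n\<^sup>2) powr (1 - \<epsilon>)) \<le> Cmax c (vec_n n) \<omega>})) = 1"
    unfolding \<mu>_def by (intro exI[of _ p] exI[of _ \<sigma>]) simp
qed

theorem theorem4p3:
  fixes Qn :: "'q::finite set"
    and T :: "('q, 'd::finite) trans set"
    and P :: "('q, 'd) trans \<Rightarrow> real"
    and y :: "'d \<Rightarrow> int" and z :: "'q \<Rightarrow> int" and c :: 'd
  assumes "vass_mdp Qn T P"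
    and "strongly_connected T"
    and "maximal_solution_II Qn T P y z"
  shows "(y c > 0 \<longrightarrow> tight_estimate Qn T P c (\<lambda>n. n)) \<and>
         (y c = 0 \<longrightarrow> lower_estimate Qn T P c (\<lambda>n. n ^ 2))"
proof (intro conjI impI)
  assume "y c > 0"
  with assms show "tight_estimate Qn T P c (\<lambda>n. n)"
    unfolding tight_estimate_def maximal_solution_II_def
    by (blast intro: lower_estimate_linear upper_estimate_linear)
next
  assume "y c = 0"
  with assms(3) have "\<not> (\<exists>y' z'. is_solution_II Qn T P y' z' \<and> y' c > 0)"
    unfolding maximal_solution_II_def by (metis less_irrefl)
  from no_positive_solution_imp_flow[OF assms(1) this] obtain x where
    x: "mdp_flow Qn T P x" "\<And>p. outflow T x p \<in> \<nat>"
      "\<And>i. (\<Sum>t\<in>T. x t * upd t i) \<ge> 0" "(\<Sum>t\<in>T. x t * upd t c) > 0"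
    by blast
  from ex_strategy_schedule[OF assms(1,2) x(1,2)] obtain js :: "'q list" and \<alpha> g h where
    opt: "\<And>p. p \<in> set js \<Longrightarrow> memoryless Qn T P (\<alpha> p)"
      "\<And>p i q. p \<in> set js \<Longrightarrow>
        chain_mean T (\<alpha> p) q (\<lambda>t. real_of_int (upd t i) + h p i (tgt t) - h p i q) = g p i"
      "\<And>i. (\<Sum>k<length js. g (js ! k) i) = (\<Sum>t\<in>T. x t * upd t i)"
    by blast
  have nn: "(\<Sum>k<length js. g (js ! k) i) \<ge> 0" for i by (rule ord_le_eq_trans[OF x(3) opt(3)[symmetric]])
  have pos: "(\<Sum>k<length js. g (js ! k) c) > 0" by (rule ord_less_eq_trans[OF x(4) opt(3)[symmetric]])
  show "lower_estimate Qn T P c (\<lambda>n. n ^ 2)"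
    by (rule lower_estimate_quadratic[OF assms(1) opt(1,2) nn pos])
qed

end
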